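(* Let $\mathbb{S}_{\mathcal{ELO}}$ be Standpoint $\mathcal{EL}$ extended by nominal concepts, i.e. concept terms $\{o\}$ for individual names $o$, interpreted by $\{o\}^{\gamma(\pi)}=\{o^{\gamma(\pi)}\}$. Then deciding satisfiability of $\mathbb{S}_{\mathcal{ELO}}$ TBoxes that use just one nominal concept $\{o\}$ is ExpTime-hard.
   Context: Syntax. A vocabulary consists of sets $N_{\mathsf{C}}$ (concept names), $N_{\mathsf{R}}$ (role names), $N_{\mathsf{I}}$ (individual names), $N_{\mathsf{S}}$ (standpoint names) with a distinguished $*\in N_{\mathsf{S}}$. Standpoint operators are $\Diamond_s$ and $\Box_s$ for $s\in N_{\mathsf{S}}$; $\odot_s$ stands for either. Concept terms of $\mathbb{S}_{\mathcal{ELO}}$: $C ::= \top \mid \bot \mid A \mid \{o\} \mid C_1\sqcap C_2 \mid \exists R.C \mid \odot_s[C]$ with $A\in N_{\mathsf{C}}$, $o\in N_{\mathsf{I}}$, $R\in N_{\mathsf{R}}$. A TBox is a finite set of general concept inclusions $\odot_s[C\sqsubseteq D]$; a GCI written without outer operator abbreviates one with outer operator $\Box_*$. Semantics. A standpoint structure is $\mathfrak{D}=\langle\Delta,\Pi,\sigma,\gamma\rangle$ with $\Delta\neq\emptyset$ a set (domain), $\Pi$ a set (precisifications), $\sigma$ a map from $N_{\mathsf{S}}$ to non-empty subsets of $\Pi$ with $\sigma( * )=\Pi$, and $\gamma$ assigning to each $\pi\in\Pi$ an ordinary description logic interpretation over $\Delta$ ($A^{\gamma(\pi)}\subseteq\Delta$,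 $R^{\gamma(\pi)}\subseteq\Delta\times\Delta$, $a^{\gamma(\pi)}\in\Delta$), with $a^{\gamma(\pi)}=a^{\gamma(\pi')}$ for all $\pi,\pi'\in\Pi$ and $a\in N_{\mathsf{I}}$. Interpretations extend to concept terms by $\top^{\gamma(\pi)}=\Delta$, $\bot^{\gamma(\pi)}=\emptyset$, $\{o\}^{\gamma(\pi)}=\{o^{\gamma(\pi)}\}$, $(C\sqcap D)^{\gamma(\pi)}=C^{\gamma(\pi)}\cap D^{\gamma(\pi)}$, $(\exists R.C)^{\gamma(\pi)}=\{\delta\mid (\delta,\varepsilon)\in R^{\gamma(\pi)}\text{ for some }\varepsilon\in C^{\gamma(\pi)}\}$, $(\Diamond_s C)^{\gamma(\pi)}=\bigcup_{\pi'\in\sigma(s)}C^{\gamma(\pi')}$, $(\Box_s C)^{\gamma(\pi)}=\bigcap_{\pi'\in\sigma(s)}C^{\gamma(\pi')}$. $\mathfrak{D}\models\Box_s[C\sqsubseteq D]$ (resp. $\Diamond_s[C\sqsubseteq D]$) iff $C^{\gamma(\pi)}\subseteq D^{\gamma(\pi)}$ for all (resp. some) $\pi\in\sigma(s)$. A TBox is satisfiable iff some standpoint structure satisfies all its GCIs. *)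

theory Defs
  imports
    "HOL-Library.Countable_Set"
    "HOL-Library.Infinite_Typeclass"
    "HOL-Computational_Algebra.Polynomial"
begin

section \<open>Standpoint \<open>\<E>\<L>\<close> with nominals\<close>

subsection \<open>Syntax\<close>

text \<open>Type parameters: concept names \<open>'c\<close>, role names \<open>'r\<close>, individual names \<open>'i\<close>;
  the standpoint names are \<open>'s\<close> together with the distinguished one, \<open>Star\<close>.\<close>

datatype 's standpoint = Star | Sp 's

datatype 's modop = Dia "'s standpoint" | Box "'s standpoint"

datatype ('c, 'r, 'i, 's) cterm =
    Top
  | Bot
  | Atom 'c
  | Nominal 'i
  | And "('c, 'r, 'i, 's) cterm" "('c, 'r, 'i, 's) cterm"
  | Ex 'r "('c, 'r, 'i, 's) cterm"
  | Modal "'s modop" "('c, 'r, 'i, 's) cterm"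

datatype ('c, 'r, 'i, 's) gci =
  GCI "'s modop" "('c, 'r, 'i, 's) cterm" "('c, 'r, 'i, 's) cterm"

fun cterm_nominals :: "('c, 'r, 'i, 's) cterm \<Rightarrow> 'i set" where
  "cterm_nominals Top = {}"
| "cterm_nominals Bot = {}"
| "cterm_nominals (Atom A) = {}"
| "cterm_nominals (Nominal a) = {a}"
| "cterm_nominals (And C D) = cterm_nominals C \<union> cterm_nominals D"
| "cterm_nominals (Ex R C) = cterm_nominals C"
| "cterm_nominals (Modal m C) = cterm_nominals C"

fun gci_nominals :: "('c, 'r, 'i, 's) gci \<Rightarrow> 'i set" where
  "gci_nominals (GCI m C D) = cterm_nominals C \<union> cterm_nominals D"

definition tbox_nominals :: "('c, 'r, 'i, 's) gci set \<Rightarrow> 'i set" where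
  "tbox_nominals T = (\<Union>g\<in>T. gci_nominals g)"


subsection \<open>Semantics\<close>

record ('c, 'r, 'i, 'd) dl_interp =
  conc_int :: "'c \<Rightarrow> 'd set"
  role_int :: "'r \<Rightarrow> ('d \<times> 'd) set"
  ind_int :: "'i \<Rightarrow> 'd"

record ('c, 'r, 'i, 's, 'd, 'p) sp_struct =
  Delta :: "'d set"
  Prec :: "'p set"
  sigma :: "'s standpoint \<Rightarrow> 'p set"
  gamma :: "'p \<Rightarrow> ('c, 'r, 'i, 'd) dl_interp"

definition dl_interpretation :: "'d set \<Rightarrow> ('c, 'r, 'i, 'd) dl_interp \<Rightarrow> bool" where
  "dl_interpretation X I \<longleftrightarrow>
     (\<forall>A. conc_int I A \<subseteq> X) \<and> (\<forall>R. role_int I R \<subseteq> X \<times> X) \<and> (\<forall>a. ind_int I a \<in> X)"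

definition standpoint_structure :: "('c, 'r, 'i, 's, 'd, 'p) sp_struct \<Rightarrow> bool" where
  "standpoint_structure S \<longleftrightarrow>
     Delta S \<noteq> {} \<and>
     (\<forall>s. sigma S s \<noteq> {} \<and> sigma S s \<subseteq> Prec S) \<and>
     sigma S Star = Prec S \<and>
     (\<forall>\<pi>\<in>Prec S. dl_interpretation (Delta S) (gamma S \<pi>)) \<and>
     (\<forall>\<pi>\<in>Prec S. \<forall>\<pi>'\<in>Prec S. \<forall>a. ind_int (gamma S \<pi>) a = ind_int (gamma S \<pi>') a)"

fun ext :: "('c, 'r, 'i, 's, 'd, 'p) sp_struct \<Rightarrow> 'p \<Rightarrow> ('c, 'r, 'i, 's) cterm \<Rightarrow> 'd set" where
  "ext S \<pi> Top = Delta S"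
| "ext S \<pi> Bot = {}"
| "ext S \<pi> (Atom A) = conc_int (gamma S \<pi>) A"
| "ext S \<pi> (Nominal a) = {ind_int (gamma S \<pi>) a}"
| "ext S \<pi> (And C D) = ext S \<pi> C \<inter> ext S \<pi> D"
| "ext S \<pi> (Ex R C) = {x. \<exists>y\<in>ext S \<pi> C. (x, y) \<in> role_int (gamma S \<pi>) R}"
| "ext S \<pi> (Modal (Dia s) C) = (\<Union>\<pi>'\<in>sigma S s. ext S \<pi>' C)"
| "ext S \<pi> (Modal (Box s) C) = (\<Inter>\<pi>'\<in>sigma S s. ext S \<pi>' C)"

fun sat_gci :: "('c, 'r, 'i, 's, 'd, 'p) sp_struct \<Rightarrow> ('c, 'r, 'i, 's) gci \<Rightarrow> bool" where
  "sat_gci S (GCI (Box s) C D) \<longleftrightarrow> (\<forall>\<pi>\<in>sigma S s. ext S \<pi> C \<subseteq> ext S \<pi> D)"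
| "sat_gci S (GCI (Dia s) C D) \<longleftrightarrow> (\<exists>\<pi>\<in>sigma S s. ext S \<pi> C \<subseteq> ext S \<pi> D)"

text \<open>Domain and precisifications of a structure are arbitrary sets of elements of the types
  \<open>'d\<close> and \<open>'p\<close>. Over countable vocabularies, any two infinite types give the same satisfiable
  TBoxes as arbitrary types do: see \<open>satisfiable_transfer\<close> below.\<close>

definition satisfiable :: "'d itself \<Rightarrow> 'p itself \<Rightarrow> ('c, 'r, 'i, 's) gci set \<Rightarrow> bool" where
  "satisfiable TYPE('d) TYPE('p) T \<longleftrightarrow>
     (\<exists>S :: ('c, 'r, 'i, 's, 'd, 'p) sp_struct. standpoint_structure S \<and> (\<forall>g\<in>T. sat_gci S g))"


section \<open>Encoding of TBoxes as binary words\<close>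

text \<open>Names are finite binary words, and a TBox is presented by a list of its GCIs.
  All syntactic objects are written in prefix notation with a prefix-free code.\<close>

type_synonym name = "bool list"
type_synonym ncterm = "(name, name, name, name) cterm"
type_synonym ngci = "(name, name, name, name) gci"

fun enc_name :: "name \<Rightarrow> bool list" where
  "enc_name [] = [False]"
| "enc_name (b # bs) = True # b # enc_name bs"

fun enc_standpoint :: "name standpoint \<Rightarrow> bool list" where
  "enc_standpoint Star = [False]"
| "enc_standpoint (Sp s) = True # enc_name s"

fun enc_modop :: "name modop \<Rightarrow> bool list" where
  "enc_modop (Dia s) = False # enc_standpoint s"
| "enc_modop (Box s) = True # enc_standpoint s"

fun enc_cterm :: "ncterm \<Rightarrow> bool list" where
  "enc_cterm Top = [False, False, False]"
| "enc_cterm Bot = [False, False, True]"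
| "enc_cterm (Atom A) = [False, True, False] @ enc_name A"
| "enc_cterm (Nominal a) = [False, True, True] @ enc_name a"
| "enc_cterm (And C D) = [True, False, False] @ enc_cterm C @ enc_cterm D"
| "enc_cterm (Ex R C) = [True, False, True] @ enc_name R @ enc_cterm C"
| "enc_cterm (Modal m C) = [True, True, False] @ enc_modop m @ enc_cterm C"

fun enc_gci :: "ngci \<Rightarrow> bool list" where
  "enc_gci (GCI m C D) = enc_modop m @ enc_cterm C @ enc_cterm D"

fun enc_tbox :: "ngci list \<Rightarrow> bool list" where
  "enc_tbox [] = [False]"
| "enc_tbox (g # gs) = True # enc_gci g @ enc_tbox gs"


section \<open>Deterministic multi-tape Turing machines\<close>

text \<open>Tapes are infinite to the right only; cell 0 initially carries the left end marker, and
  moving left from cell 0 has no effect.\<close>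

datatype sym = Blank | Start | Bit bool | Aux nat

datatype dir = MoveLeft | Stay | MoveRight

record tm =
  tapes :: nat
  states :: "nat set"
  symbols :: "sym set"
  init :: nat
  accept :: nat
  reject :: nat
  delta :: "nat \<Rightarrow> sym list \<Rightarrow> nat \<times> (sym \<times> dir) list"

definition turing_machine :: "tm \<Rightarrow> bool" where
  "turing_machine M \<longleftrightarrow>
     tapes M \<ge> 1 \<and> finite (states M) \<and> finite (symbols M) \<and>
     {Blank, Start, Bit False, Bit True} \<subseteq> symbols M \<and>
     {init M, accept M, reject M} \<subseteq> states M \<and> accept M \<noteq> reject M \<and>
     (\<forall>q xs q' as. q \<in> states M \<longrightarrow> length xs = tapes M \<longrightarrow> set xs \<subseteq> symbols M \<longrightarrow>
        delta M q xs = (q', as) \<longrightarrow>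
        q' \<in> states M \<and> length as = tapes M \<and> fst ` set as \<subseteq> symbols M)"

type_synonym tape = "(nat \<Rightarrow> sym) \<times> nat"
type_synonym config = "nat \<times> tape list"

definition read_tape :: "tape \<Rightarrow> sym" where
  "read_tape t = fst t (snd t)"

fun move :: "dir \<Rightarrow> nat \<Rightarrow> nat" where
  "move MoveLeft h = h - 1"
| "move Stay h = h"
| "move MoveRight h = h + 1"

definition act :: "sym \<times> dir \<Rightarrow> tape \<Rightarrow> tape" where
  "act a t = ((fst t)(snd t := fst a), move (snd a) (snd t))"

definition halted :: "tm \<Rightarrow> config \<Rightarrow> bool" where
  "halted M c \<longleftrightarrow> fst c \<in> {accept M, reject M}"

text \<open>Halted configurations are fixed points of the step function, so the configuration after
  exactly \<open>t\<close> steps is the final one for every machine that halts within \<open>t\<close> steps.\<close>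

definition tm_step :: "tm \<Rightarrow> config \<Rightarrow> config" where
  "tm_step M c =
     (if halted M c then c
      else let (q, as) = delta M (fst c) (map read_tape (snd c)) in (q, map2 act as (snd c)))"

definition word_tape :: "bool list \<Rightarrow> nat \<Rightarrow> sym" where
  "word_tape w i =
     (if i = 0 then Start else if i \<le> length w then Bit (w ! (i - 1)) else Blank)"

definition start_config :: "tm \<Rightarrow> bool list \<Rightarrow> config" where
  "start_config M w =
     (init M, (word_tape w, 0) # replicate (tapes M - 1) (word_tape [], 0))"

definition tm_run :: "tm \<Rightarrow> bool list \<Rightarrow> nat \<Rightarrow> config" where
  "tm_run M w t = (tm_step M ^^ t) (start_config M w)"

definition decides_in_time :: "tm \<Rightarrow> bool list set \<Rightarrow> (nat \<Rightarrow> nat) \<Rightarrow> bool" where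
  "decides_in_time M L T \<longleftrightarrow>
     (\<forall>w. fst (tm_run M w (T (length w))) = (if w \<in> L then accept M else reject M))"

text \<open>The output is the content of the last tape.\<close>

definition computes_in_time :: "tm \<Rightarrow> (bool list \<Rightarrow> bool list) \<Rightarrow> (nat \<Rightarrow> nat) \<Rightarrow> bool" where
  "computes_in_time M f T \<longleftrightarrow>
     (\<forall>w. let c = tm_run M w (T (length w))
          in halted M c \<and> fst (last (snd c)) = word_tape (f w))"


section \<open>ExpTime-hardness\<close>

definition EXPTIME :: "bool list set set" where
  "EXPTIME = {L. \<exists>M (p :: nat poly). turing_machine M \<and> decides_in_time M L (\<lambda>n. 2 ^ poly p n)}"

definition polytime_computable :: "(bool list \<Rightarrow> bool list) \<Rightarrow> bool" where
  "polytime_computable f \<longleftrightarrow>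
     (\<exists>M (p :: nat poly). turing_machine M \<and> computes_in_time M f (\<lambda>n. poly p n))"

text \<open>Deciding \<open>P\<close> on the instances \<open>I\<close>, presented through the encoding \<open>enc\<close>, is hard for
  ExpTime under polynomial-time many-one reductions. The reduction only produces
  words encoding members of \<open>I\<close>.\<close>

definition exptime_hard :: "('a \<Rightarrow> bool list) \<Rightarrow> 'a set \<Rightarrow> ('a \<Rightarrow> bool) \<Rightarrow> bool" where
  "exptime_hard enc I P \<longleftrightarrow>
     (\<forall>L\<in>EXPTIME. \<exists>g. (\<forall>w. g w \<in> I \<and> (w \<in> L \<longleftrightarrow> P (g w))) \<and>
                      polytime_computable (\<lambda>w. enc (g w)))"


section \<open>The encoding is injective\<close>

lemma enc_name_prefix: "enc_name a @ x = enc_name b @ y \<Longrightarrow> a = b \<and> x = y"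
proof (induction a arbitrary: b)
  case Nil then show ?case by (cases b) auto
next
  case (Cons c a) then show ?case by (cases b) auto
qed

lemma enc_modop_prefix: "enc_modop a @ x = enc_modop b @ y \<Longrightarrow> a = b \<and> x = y"
  by (cases a; cases b; (elim enc_modop.elims)?;
      rename_tac s t; case_tac s; case_tac t; auto dest: enc_name_prefix)

lemma enc_cterm_prefix: "enc_cterm a @ x = enc_cterm b @ y \<Longrightarrow> a = b \<and> x = y"
proof (induction a arbitrary: b x y)
  case Top then show ?case by (cases b) auto
next
  case Bot then show ?case by (cases b) auto
next
  case (Atom A) then show ?case by (cases b) (auto dest: enc_name_prefix)
next
  case (Nominal a) then show ?case by (cases b) (auto dest: enc_name_prefix)
next
  case (And C D) from And.prems show ?case by (cases b) (auto dest!: And.IH)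
next
  case (Ex R C) from Ex.prems show ?case by (cases b) (auto dest!: enc_name_prefix Ex.IH)
next
  case (Modal m C) from Modal.prems show ?case
    by (cases b) (auto dest!: enc_modop_prefix Modal.IH)
qed

lemma enc_gci_prefix: "enc_gci a @ x = enc_gci b @ y \<Longrightarrow> a = b \<and> x = y"
  by (cases a; cases b) (auto dest!: enc_modop_prefix enc_cterm_prefix)

lemma inj_enc_tbox: "inj enc_tbox"
proof -
  have "enc_tbox S = enc_tbox T \<Longrightarrow> S = T" for S T
  proof (induction S arbitrary: T)
    case Nil then show ?case by (cases T) auto
  next
    case (Cons g S) from Cons.prems show ?case
      by (cases T) (auto dest!: enc_gci_prefix Cons.IH)
  qed
  then show ?thesis by (auto intro: injI)
qed

section \<open>Independence of satisfiability from the underlying types\<close>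

instance standpoint :: (countable) countable by countable_datatype
instance modop :: (countable) countable by countable_datatype
instance cterm :: (countable, countable, countable, countable) countable by countable_datatype
instance gci :: (countable, countable, countable, countable) countable by countable_datatype

lemma standpoint_structureD:
  assumes "standpoint_structure S"
  shows "sigma S s \<noteq> {}" "sigma S s \<subseteq> Prec S"
    "\<pi> \<in> Prec S \<Longrightarrow> conc_int (gamma S \<pi>) A \<subseteq> Delta S"
    "\<pi> \<in> Prec S \<Longrightarrow> role_int (gamma S \<pi>) R \<subseteq> Delta S \<times> Delta S"
    "\<pi> \<in> Prec S \<Longrightarrow> ind_int (gamma S \<pi>) a \<in> Delta S"
    "Delta S \<noteq> {}" "sigma S Star = Prec S"
    "\<pi> \<in> Prec S \<Longrightarrow> \<pi>' \<in> Prec S \<Longrightarrow> ind_int (gamma S \<pi>) a = ind_int (gamma S \<pi>') a"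
proof -
  note S = assms[unfolded standpoint_structure_def]
  show "sigma S s \<noteq> {}" "sigma S s \<subseteq> Prec S" "Delta S \<noteq> {}" "sigma S Star = Prec S"
    using S by blast+
  have "\<forall>\<pi>\<in>Prec S. dl_interpretation (Delta S) (gamma S \<pi>)" using S by (elim conjE)
  then show "\<pi> \<in> Prec S \<Longrightarrow> conc_int (gamma S \<pi>) A \<subseteq> Delta S"
    "\<pi> \<in> Prec S \<Longrightarrow> role_int (gamma S \<pi>) R \<subseteq> Delta S \<times> Delta S"
    "\<pi> \<in> Prec S \<Longrightarrow> ind_int (gamma S \<pi>) a \<in> Delta S"
    by (simp_all add: dl_interpretation_def)
  have "\<forall>\<pi>\<in>Prec S. \<forall>\<pi>'\<in>Prec S. \<forall>a. ind_int (gamma S \<pi>) a = ind_int (gamma S \<pi>') a"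
    using S by (elim conjE)
  then show "\<pi> \<in> Prec S \<Longrightarrow> \<pi>' \<in> Prec S \<Longrightarrow> ind_int (gamma S \<pi>) a = ind_int (gamma S \<pi>') a"
    by blast
qed

lemma ext_subset_Delta:
  assumes S: "standpoint_structure S" and "\<pi> \<in> Prec S"
  shows "ext S \<pi> C \<subseteq> Delta S"
  using assms(2)
proof (induction C arbitrary: \<pi>)
  case (Modal m C)
  show ?case
  proof (cases m)
    case (Dia s)
    then show ?thesis using Modal.IH standpoint_structureD(2)[OF S, of s] by fastforce
  next
    case (Box s)
    obtain \<pi>' where "\<pi>' \<in> sigma S s" "\<pi>' \<in> Prec S"
      using standpoint_structureD(1,2)[OF S, of s] by blast
    then show ?thesis using Modal.IH[of \<pi>'] Box by auto
  qed
next
  case (Ex R C)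
  then show ?case using standpoint_structureD(4)[OF S, of \<pi> R] by auto
next
  case (Atom A)
  then show ?case using standpoint_structureD(3)[OF S, of \<pi> A] by simp
next
  case (Nominal a)
  then show ?case using standpoint_structureD(5)[OF S, of \<pi> a] by simp
qed auto

lemma inj_on_countable_infinite:
  assumes "countable (X :: 'e set)"
  obtains f :: "'e \<Rightarrow> 'd::infinite" where "inj_on f X"
proof -
  obtain c :: "nat \<Rightarrow> 'd" where c: "inj c"
    using infinite_countable_subset[of "UNIV :: 'd set"] infinite_UNIV by blast
  have "inj_on (c \<circ> to_nat_on X) X"
    using assms c by (meson comp_inj_on inj_on_subset inj_on_to_nat_on subset_UNIV)
  then show thesis by (rule that)
qed

lemma countable_inj_vimage: "inj f \<Longrightarrow> countable A \<Longrightarrow> countable (f -` A)"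
  by (meson countable_image_inj_on countable_subset image_vimage_subset inj_on_subset subset_UNIV)

lemma countable_closed_subsets:
  fixes S :: "('c::countable, 'r::countable, 'i::countable, 's::countable, 'e, 'q) sp_struct"
  assumes S: "standpoint_structure S"
  obtains X Y where
    "countable X" "countable Y" "X \<subseteq> Delta S" "X \<noteq> {}" "Y \<subseteq> Prec S"
    "\<And>s. sigma S s \<inter> Y \<noteq> {}"
    "\<And>\<pi> a. \<pi> \<in> Y \<Longrightarrow> ind_int (gamma S \<pi>) a \<in> X"
    "\<And>x \<pi> R C. x \<in> X \<Longrightarrow> \<pi> \<in> Y \<Longrightarrow> x \<in> ext S \<pi> (Ex R C) \<Longrightarrow>
       \<exists>y\<in>X. y \<in> ext S \<pi> C \<and> (x, y) \<in> role_int (gamma S \<pi>) R"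
    "\<And>x s C. x \<in> X \<Longrightarrow> \<exists>\<pi>'\<in>sigma S s. x \<in> ext S \<pi>' C \<Longrightarrow>
       \<exists>\<pi>'\<in>sigma S s \<inter> Y. x \<in> ext S \<pi>' C"
    "\<And>x s C. x \<in> X \<Longrightarrow> \<exists>\<pi>'\<in>sigma S s. x \<notin> ext S \<pi>' C \<Longrightarrow>
       \<exists>\<pi>'\<in>sigma S s \<inter> Y. x \<notin> ext S \<pi>' C"
    "\<And>s C D. \<exists>\<pi>\<in>sigma S s. ext S \<pi> C \<subseteq> ext S \<pi> D \<Longrightarrow>
       \<exists>\<pi>\<in>sigma S s \<inter> Y. ext S \<pi> C \<subseteq> ext S \<pi> D"
proof -
  define \<pi>0 where "\<pi>0 = (SOME \<pi>. \<pi> \<in> sigma S Star)"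
  have \<pi>0: "\<pi>0 \<in> Prec S" unfolding \<pi>0_def
    using standpoint_structureD(1,7)[OF S] by (metis some_in_eq)
  obtain x0 where x0: "x0 \<in> Delta S" using standpoint_structureD(6)[OF S] by blast
  have sig: "\<pi> \<in> Prec S" if "\<pi> \<in> sigma S s" for \<pi> s
    using that standpoint_structureD(2)[OF S, of s] by blast
  define wE where "wE = (\<lambda>(x, \<pi>, R, C).
     Inl (SOME y. y \<in> Delta S \<and> (x \<in> ext S \<pi> (Ex R C) \<longrightarrow>
       y \<in> ext S \<pi> C \<and> (x, y) \<in> role_int (gamma S \<pi>) R)) :: 'e + 'q)"
  define wP where "wP = (\<lambda>(x, s, C).
     Inr (SOME \<pi>. \<pi> \<in> sigma S s \<and> ((\<exists>\<pi>'\<in>sigma S s. x \<in> ext S \<pi>' C) \<longrightarrow>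
       x \<in> ext S \<pi> C)) :: 'e + 'q)"
  define wN where "wN = (\<lambda>(x, s, C).
     Inr (SOME \<pi>. \<pi> \<in> sigma S s \<and> ((\<exists>\<pi>'\<in>sigma S s. x \<notin> ext S \<pi>' C) \<longrightarrow>
       x \<notin> ext S \<pi> C)) :: 'e + 'q)"
  define wG where "wG = (\<lambda>(s, C, D).
     Inr (SOME \<pi>. \<pi> \<in> sigma S s \<and> ((\<exists>\<pi>\<in>sigma S s. ext S \<pi> C \<subseteq> ext S \<pi> D) \<longrightarrow>
       ext S \<pi> C \<subseteq> ext S \<pi> D)) :: 'e + 'q)"
  have wE: "\<exists>y. wE (x, \<pi>, R, C) = Inl y \<and> y \<in> Delta S \<and> (x \<in> ext S \<pi> (Ex R C) \<longrightarrow>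
       y \<in> ext S \<pi> C \<and> (x, y) \<in> role_int (gamma S \<pi>) R)" if "\<pi> \<in> Prec S" for x \<pi> R C
  proof -
    have "\<exists>y. y \<in> Delta S \<and> (x \<in> ext S \<pi> (Ex R C) \<longrightarrow>
       y \<in> ext S \<pi> C \<and> (x, y) \<in> role_int (gamma S \<pi>) R)"
      using x0 ext_subset_Delta[OF S that, of C] by (cases "x \<in> ext S \<pi> (Ex R C)") auto
    from someI_ex[OF this] show ?thesis unfolding wE_def by auto
  qed
  have ne: "\<exists>\<pi>. \<pi> \<in> sigma S s" for s using standpoint_structureD(1)[OF S, of s] by blast
  have wP: "\<exists>\<pi>. wP (x, s, C) = Inr \<pi> \<and> \<pi> \<in> sigma S s \<and>
      ((\<exists>\<pi>'\<in>sigma S s. x \<in> ext S \<pi>' C) \<longrightarrow> x \<in> ext S \<pi> C)" for x s C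
  proof -
    have "\<exists>\<pi>. \<pi> \<in> sigma S s \<and> ((\<exists>\<pi>'\<in>sigma S s. x \<in> ext S \<pi>' C) \<longrightarrow> x \<in> ext S \<pi> C)"
      using ne[of s] by blast
    from someI_ex[OF this] show ?thesis unfolding wP_def by simp
  qed
  have wN: "\<exists>\<pi>. wN (x, s, C) = Inr \<pi> \<and> \<pi> \<in> sigma S s \<and>
      ((\<exists>\<pi>'\<in>sigma S s. x \<notin> ext S \<pi>' C) \<longrightarrow> x \<notin> ext S \<pi> C)" for x s C
  proof -
    have "\<exists>\<pi>. \<pi> \<in> sigma S s \<and> ((\<exists>\<pi>'\<in>sigma S s. x \<notin> ext S \<pi>' C) \<longrightarrow> x \<notin> ext S \<pi> C)"
      using ne[of s] by blast
    from someI_ex[OF this] show ?thesis unfolding wN_def by simp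
  qed
  have wG: "\<exists>\<pi>. wG (s, C, D) = Inr \<pi> \<and> \<pi> \<in> sigma S s \<and>
      ((\<exists>\<pi>\<in>sigma S s. ext S \<pi> C \<subseteq> ext S \<pi> D) \<longrightarrow> ext S \<pi> C \<subseteq> ext S \<pi> D)" for s C D
  proof -
    have "\<exists>\<pi>. \<pi> \<in> sigma S s \<and>
      ((\<exists>\<pi>\<in>sigma S s. ext S \<pi> C \<subseteq> ext S \<pi> D) \<longrightarrow> ext S \<pi> C \<subseteq> ext S \<pi> D)"
      using ne[of s] by blast
    from someI_ex[OF this] show ?thesis unfolding wG_def by simp
  qed
  define G where "G = Delta S <+> Prec S"
  define F where "F = (\<lambda>Z. Z \<union> wE ` ((Inl -` Z) \<times> (Inr -` Z) \<times> UNIV \<times> UNIV) \<union>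
     wP ` ((Inl -` Z) \<times> UNIV \<times> UNIV) \<union> wN ` ((Inl -` Z) \<times> UNIV \<times> UNIV))"
  define Z where "Z = (\<lambda>n. (F ^^ n)
     (insert (Inl x0) (range (\<lambda>a. Inl (ind_int (gamma S \<pi>0) a)) \<union> range wG)))"
  have ZS: "Z (Suc n) = F (Z n)" for n by (simp add: Z_def)
  have mono: "Z m \<subseteq> Z n" if "m \<le> n" for m n
    using that by (rule lift_Suc_mono_le[rotated]) (auto simp: ZS F_def)
  have "countable (Z n)" for n
  proof (induction n)
    case 0 show ?case by (simp add: Z_def)
  next
    case (Suc n)
    have "countable (Inl -` Z n)" "countable (Inr -` Z n)"
      using Suc by (auto intro: countable_inj_vimage)
    then show ?case using Suc unfolding ZS F_def
      by (intro countable_Un countable_image countable_SIGMA) auto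
  qed
  then have cU: "countable (\<Union>n. Z n)" by auto
  have "Z n \<subseteq> G" for n
  proof (induction n)
    case 0
    have "wG z \<in> G" for z using wG[of "fst z" "fst (snd z)" "snd (snd z)"]
      by (auto simp: G_def sig)
    moreover have "ind_int (gamma S \<pi>0) a \<in> Delta S" for a
      using standpoint_structureD(5)[OF S \<pi>0] .
    ultimately show ?case using x0 by (auto simp: Z_def G_def)
  next
    case (Suc n)
    have "wE (x, \<pi>, R, C) \<in> G" if "Inr \<pi> \<in> Z n" for x \<pi> R C
    proof -
      have "\<pi> \<in> Prec S" using that Suc by (auto simp: G_def)
      from wE[OF this, of x R C] show ?thesis by (auto simp: G_def)
    qed
    moreover have "wP z \<in> G" "wN z \<in> G" for z
      using wP[of "fst z" "fst (snd z)" "snd (snd z)"]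
        wN[of "fst z" "fst (snd z)" "snd (snd z)"] by (auto simp: G_def sig)
    ultimately show ?case using Suc unfolding ZS F_def by auto
  qed
  then have sub: "(\<Union>n. Z n) \<subseteq> G" by blast
  define X where "X = {x. Inl x \<in> (\<Union>n. Z n)}"
  define Y where "Y = {x. Inr x \<in> (\<Union>n. Z n)}"
  have YP: "Y \<subseteq> Prec S" using sub by (auto simp: Y_def G_def)
  have Z0: "Inl x0 \<in> Z 0" "Inl (ind_int (gamma S \<pi>0) a) \<in> Z 0" "wG z \<in> Z 0" for a z
    by (auto simp: Z_def)
  have G: "\<exists>\<pi>\<in>sigma S s \<inter> Y. (\<exists>\<pi>\<in>sigma S s. ext S \<pi> C \<subseteq> ext S \<pi> D) \<longrightarrow>
      ext S \<pi> C \<subseteq> ext S \<pi> D" for s C D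
    using wG[of s C D] Z0(3)[of "(s, C, D)"] by (auto simp: Y_def intro!: exI[of _ "0::nat"])
  show thesis
  proof (rule that[of X Y])
    show "countable X" "countable Y"
      using countable_inj_vimage[OF _ cU, of Inl] countable_inj_vimage[OF _ cU, of Inr]
      by (simp_all add: X_def Y_def vimage_def)
    show "X \<subseteq> Delta S" using sub by (auto simp: X_def G_def)
    show "X \<noteq> {}" using Z0(1) by (auto simp: X_def)
    show "Y \<subseteq> Prec S" by (fact YP)
    show "sigma S s \<inter> Y \<noteq> {}" for s using G[of s] by blast
    show "ind_int (gamma S \<pi>) a \<in> X" if "\<pi> \<in> Y" for \<pi> a
    proof -
      have "ind_int (gamma S \<pi>) a = ind_int (gamma S \<pi>0) a"
        using standpoint_structureD(8)[OF S] that YP \<pi>0 by blast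
      then show ?thesis using Z0(2)[of a] by (auto simp: X_def)
    qed
    show "\<exists>y\<in>X. y \<in> ext S \<pi> C \<and> (x, y) \<in> role_int (gamma S \<pi>) R"
      if asm: "x \<in> X" "\<pi> \<in> Y" "x \<in> ext S \<pi> (Ex R C)" for x \<pi> R C
    proof -
      from that obtain m n where "Inl x \<in> Z m" "Inr \<pi> \<in> Z n" by (auto simp: X_def Y_def)
      then have "Inl x \<in> Z (max m n)" "Inr \<pi> \<in> Z (max m n)"
        using mono[of m "max m n"] mono[of n "max m n"] by auto
      then have "wE (x, \<pi>, R, C) \<in> Z (Suc (max m n))" unfolding ZS F_def by blast
      moreover obtain y where "wE (x, \<pi>, R, C) = Inl y"
        "y \<in> ext S \<pi> C" "(x, y) \<in> role_int (gamma S \<pi>) R"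
        using wE[of \<pi> x R C] asm YP by blast
      ultimately show ?thesis unfolding X_def by auto
    qed
    show "\<exists>\<pi>'\<in>sigma S s \<inter> Y. x \<in> ext S \<pi>' C"
      if asm: "x \<in> X" "\<exists>\<pi>'\<in>sigma S s. x \<in> ext S \<pi>' C" for x s C
    proof -
      from that obtain n where "Inl x \<in> Z n" by (auto simp: X_def)
      then have "wP (x, s, C) \<in> Z (Suc n)" unfolding ZS F_def by blast
      moreover obtain \<pi> where "wP (x, s, C) = Inr \<pi>" "\<pi> \<in> sigma S s" "x \<in> ext S \<pi> C"
        using wP[of x s C] asm by blast
      ultimately show ?thesis unfolding Y_def by auto
    qed
    show "\<exists>\<pi>'\<in>sigma S s \<inter> Y. x \<notin> ext S \<pi>' C"
      if asm: "x \<in> X" "\<exists>\<pi>'\<in>sigma S s. x \<notin> ext S \<pi>' C" for x s C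
    proof -
      from that obtain n where "Inl x \<in> Z n" by (auto simp: X_def)
      then have "wN (x, s, C) \<in> Z (Suc n)" unfolding ZS F_def by blast
      moreover obtain \<pi> where "wN (x, s, C) = Inr \<pi>" "\<pi> \<in> sigma S s" "x \<notin> ext S \<pi> C"
        using wN[of x s C] asm by blast
      ultimately show ?thesis unfolding Y_def by auto
    qed
    show "\<exists>\<pi>\<in>sigma S s \<inter> Y. ext S \<pi> C \<subseteq> ext S \<pi> D"
      if "\<exists>\<pi>\<in>sigma S s. ext S \<pi> C \<subseteq> ext S \<pi> D" for s C D
      using G[of s C D] that by blast
  qed
qed

theorem satisfiable_transfer:
  fixes T :: "('c::countable, 'r::countable, 'i::countable, 's::countable) gci set"
  assumes "satisfiable TYPE('e) TYPE('q) T"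
  shows "satisfiable TYPE('d::infinite) TYPE('p::infinite) T"
proof -
  from assms obtain S :: "('c, 'r, 'i, 's, 'e, 'q) sp_struct"
    where S: "standpoint_structure S" and T: "\<And>g. g \<in> T \<Longrightarrow> sat_gci S g"
    unfolding satisfiable_def by blast
  show ?thesis
  proof (rule countable_closed_subsets[OF S])
    fix X Y
    assume
      c: "countable X" "countable Y" and X: "X \<subseteq> Delta S" "X \<noteq> {}" and Y: "Y \<subseteq> Prec S" and
      s: "\<And>s. sigma S s \<inter> Y \<noteq> {}" and
      ind: "\<And>\<pi> a. \<pi> \<in> Y \<Longrightarrow> ind_int (gamma S \<pi>) a \<in> X" and
      ex: "\<And>x \<pi> R C. x \<in> X \<Longrightarrow> \<pi> \<in> Y \<Longrightarrow> x \<in> ext S \<pi> (Ex R C) \<Longrightarrow>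
         \<exists>y\<in>X. y \<in> ext S \<pi> C \<and> (x, y) \<in> role_int (gamma S \<pi>) R" and
      dia: "\<And>x s C. x \<in> X \<Longrightarrow> \<exists>\<pi>'\<in>sigma S s. x \<in> ext S \<pi>' C \<Longrightarrow>
         \<exists>\<pi>'\<in>sigma S s \<inter> Y. x \<in> ext S \<pi>' C" and
      box: "\<And>x s C. x \<in> X \<Longrightarrow> \<exists>\<pi>'\<in>sigma S s. x \<notin> ext S \<pi>' C \<Longrightarrow>
         \<exists>\<pi>'\<in>sigma S s \<inter> Y. x \<notin> ext S \<pi>' C" and
      gci: "\<And>s C D. \<exists>\<pi>\<in>sigma S s. ext S \<pi> C \<subseteq> ext S \<pi> D \<Longrightarrow>
         \<exists>\<pi>\<in>sigma S s \<inter> Y. ext S \<pi> C \<subseteq> ext S \<pi> D"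
    obtain f :: "'e \<Rightarrow> 'd" where f: "inj_on f X" using inj_on_countable_infinite[OF c(1)] .
    obtain h :: "'q \<Rightarrow> 'p" where h: "inj_on h Y" using inj_on_countable_infinite[OF c(2)] .
    define k where "k = inv_into Y h"
    have k: "k (h \<pi>) = \<pi>" if "\<pi> \<in> Y" for \<pi> using that h by (simp add: k_def)
    define S' :: "('c, 'r, 'i, 's, 'd, 'p) sp_struct" where
      "S' = \<lparr>Delta = f ` X, Prec = h ` Y, sigma = (\<lambda>s. h ` (sigma S s \<inter> Y)),
         gamma = (\<lambda>p. \<lparr>conc_int = (\<lambda>A. f ` (conc_int (gamma S (k p)) A \<inter> X)),
           role_int = (\<lambda>R. map_prod f f ` (role_int (gamma S (k p)) R \<inter> X \<times> X)),
           ind_int = (\<lambda>a. f (ind_int (gamma S (k p)) a))\<rparr>)\<rparr>"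
    have rigid: "ind_int (gamma S \<pi>) a = ind_int (gamma S \<pi>') a"
      if "\<pi> \<in> Y" "\<pi>' \<in> Y" for \<pi> \<pi>' a
      using standpoint_structureD(8)[OF S] that Y by blast
    have star: "sigma S Star \<inter> Y = Y" using standpoint_structureD(7)[OF S] Y by blast
    have rig': "ind_int (gamma S' p) a = ind_int (gamma S' p') a" if "p \<in> h ` Y" "p' \<in> h ` Y" for p p' a
    proof -
      from that obtain \<pi> \<pi>' where "\<pi> \<in> Y" "p = h \<pi>" "\<pi>' \<in> Y" "p' = h \<pi>'" by blast
      then show ?thesis using rigid[of \<pi> \<pi>' a] by (simp add: S'_def k)
    qed
    have dl: "dl_interpretation (Delta S') (gamma S' p)" if "p \<in> h ` Y" for p
      using that ind by (auto simp: S'_def dl_interpretation_def k)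
    have sig': "Delta S' \<noteq> {}" "Prec S' = h ` Y" "sigma S' Star = Prec S'"
        "sigma S' s \<noteq> {}" "sigma S' s \<subseteq> Prec S'" for s
      using X(2) s star by (auto simp: S'_def)
    have S': "standpoint_structure S'"
      unfolding standpoint_structure_def
      by (intro conjI allI ballI sig' dl rig') (simp_all add: sig'(2))
    have ext: "ext S' (h \<pi>) C = f ` (ext S \<pi> C \<inter> X)" if "\<pi> \<in> Y" for \<pi> C
      using that
    proof (induction C arbitrary: \<pi>)
      case Top then show ?case using X by (auto simp: S'_def)
    next
      case (Nominal a) then show ?case using ind by (auto simp: S'_def k)
    next
      case (And C D)
      then show ?case using f by (auto simp: inj_on_image_Int inj_on_eq_iff)
    next
      case (Ex R C)
      have "x \<in> ext S' (h \<pi>) (Ex R C) \<longleftrightarrow> x \<in> f ` (ext S \<pi> (Ex R C) \<inter> X)" for x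
      proof
        assume "x \<in> ext S' (h \<pi>) (Ex R C)"
        then obtain y u v where "y \<in> ext S \<pi> C" "y \<in> X" "(u, v) \<in> role_int (gamma S \<pi>) R"
          "u \<in> X" "v \<in> X" "x = f u" "f y = f v"
          using Ex by (auto simp: S'_def k)
        moreover from this have "y = v" using f by (simp add: inj_on_eq_iff)
        ultimately show "x \<in> f ` (ext S \<pi> (Ex R C) \<inter> X)" by auto
      next
        assume "x \<in> f ` (ext S \<pi> (Ex R C) \<inter> X)"
        then obtain u where u: "u \<in> X" "u \<in> ext S \<pi> (Ex R C)" "x = f u" by blast
        with ex[OF u(1) Ex.prems u(2)] obtain v where v: "v \<in> X" "v \<in> ext S \<pi> C"
          "(u, v) \<in> role_int (gamma S \<pi>) R" by blast
        have "f v \<in> ext S' (h \<pi>) C" using Ex v by auto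
        moreover have "(f u, f v) \<in> role_int (gamma S' (h \<pi>)) R"
          using Ex.prems u v by (force simp: S'_def k)
        ultimately show "x \<in> ext S' (h \<pi>) (Ex R C)" using u by auto
      qed
      then show ?case by blast
    next
      case (Modal m C)
      show ?case
      proof (cases m)
        case m: (Dia s)
        have "ext S' (h \<pi>) (Modal m C) = (\<Union>\<pi>'\<in>sigma S s \<inter> Y. f ` (ext S \<pi>' C \<inter> X))"
          using m Modal.IH by (auto simp: S'_def)
        also have "\<dots> = f ` ((\<Union>\<pi>'\<in>sigma S s. ext S \<pi>' C) \<inter> X)"
          using dia[of _ s C] by fastforce
        finally show ?thesis using m by simp
      next
        case m: (Box s)
        have "ext S' (h \<pi>) (Modal m C) = (\<Inter>\<pi>'\<in>sigma S s \<inter> Y. f ` (ext S \<pi>' C \<inter> X))"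
          using m Modal.IH by (auto simp: S'_def)
        also have "\<dots> = f ` (\<Inter>\<pi>'\<in>sigma S s \<inter> Y. ext S \<pi>' C \<inter> X)"
        proof -
          obtain \<pi>1 where "\<pi>1 \<in> sigma S s \<inter> Y" using s[of s] by blast
          then show ?thesis using f by (intro image_INT[symmetric, where C=X]) auto
        qed
        also have "(\<Inter>\<pi>'\<in>sigma S s \<inter> Y. ext S \<pi>' C \<inter> X) = (\<Inter>\<pi>'\<in>sigma S s. ext S \<pi>' C) \<inter> X"
          using box[of _ s C] s[of s] by blast
        finally show ?thesis using m by simp
      qed
    qed (auto simp: S'_def k)
    have "sat_gci S' g" if "g \<in> T" for g
    proof (cases g)
      case (GCI m C D)
      show ?thesis
      proof (cases m)
        case (Dia s)
        with T[OF that] GCI gci[of s C D] obtain \<pi> where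
          "\<pi> \<in> sigma S s" "\<pi> \<in> Y" "ext S \<pi> C \<subseteq> ext S \<pi> D" by auto
        then have "h \<pi> \<in> sigma S' s" "ext S' (h \<pi>) C \<subseteq> ext S' (h \<pi>) D"
          by (auto simp: S'_def ext[unfolded S'_def])
        then show ?thesis using GCI Dia by auto
      next
        case (Box s)
        have "ext S' p C \<subseteq> ext S' p D" if "p \<in> sigma S' s" for p
        proof -
          from that obtain \<pi> where "\<pi> \<in> sigma S s" "\<pi> \<in> Y" "p = h \<pi>" by (auto simp: S'_def)
          moreover from this T[OF \<open>g \<in> T\<close>] GCI Box have "ext S \<pi> C \<subseteq> ext S \<pi> D" by auto
          ultimately show ?thesis by (auto simp: ext)
        qed
        then show ?thesis using GCI Box by auto
      qed
    qed
    with S' show ?thesis unfolding satisfiable_def by blast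
  qed
qed

end

theory Submission
  imports Defs
begin

text \<open>A deterministic exponential-time computation is unfolded backwards into nodes (time, offset from
  the heads), both coordinates being written in binary by polynomially many rigid concepts. Each
  node has five children, one time step earlier, whose values determine its own value. The edge from
  a node to a child lives in a precisification of its own, where only the node is active and only the
  child is a successor; there the nominal serves as a blackboard: the active node posts the bits of
  the child on it, and the child reads them off, which simulates the missing value restrictions.
  The nominal is also the root, i.e. the last time at offset \<open>0\<close>, and there every value with a
  non-accepting state is inconsistent.

  Polynomial-time computability of the reduction is shown with counter programs, which a Turing
  machine executes by using the head positions on tapes it never writes to as counters.\<close>

section \<open>Bitwise successor and predecessor\<close>

text \<open>No rule concludes with a disjunction. So whatever the rules force holds in every model,
  surplus facts in a model do no harm, and the TBox is unsatisfiable as soon as a bad value is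
  forced at the root. This suits a computation in which each value is a function of earlier ones.
  The converse needs a single structure in which only the intended facts hold.

  Measuring cells from the heads removes head positions from the rules: the scanned symbols are
  always at offset 0, a move is a shift by one offset, and offset -1 shows whether a head stands on
  cell 0, where a left move has no effect. These needs account for the five children.

  Both counters wrap modulo 2 ^ m, so every node can have all its children without a guard, and the
  last time is simply -1, all bits 1. The only tests on counters are "equal to 0" and "equal to -1",
  and these are the final carries of the decrement and the increment.

  Each rule mentions bits or positions relative to one index only, and indices are written in unary
  in the names; this is what makes the TBox printable with a few counters.\<close>

datatype counter_op = TimeDec | OffDec | OffInc

instance counter_op :: countable by countable_datatype

fun upd :: "counter_op \<Rightarrow> int \<Rightarrow> int" where
  "upd OffInc x = x + 1"
| "upd _ x = x - 1"

text \<open>The bit value through which a carry passes on: 1 when adding one, 0 when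
  borrowing.\<close>

definition flips :: "counter_op \<Rightarrow> bool" where
  "flips op \<longleftrightarrow> op = OffInc"

text \<open>Divisibility expresses that all bits below \<open>j\<close> equal
  \<open>flips op\<close>. At \<open>j = m\<close> it becomes the test for 0 (decrement) or -1
  (increment) modulo 2 ^ m.\<close>

definition carry :: "counter_op \<Rightarrow> nat \<Rightarrow> int \<Rightarrow> bool" where
  "carry op j x \<longleftrightarrow> 2 ^ j dvd (if flips op then x + 1 else x)"

lemma carry_0: "carry op 0 x"
  by (simp add: carry_def)

text \<open>By halving: for even \<open>x\<close> the borrow continues into \<open>x div 2\<close>;
  for odd \<open>x\<close> it ends at bit 0 and the quotient stays the same.\<close>

lemma bit_pred: "bit (x - 1 :: int) j \<longleftrightarrow> (bit x j \<noteq> (2 ^ j dvd x))"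
proof (induction j arbitrary: x)
  case 0 then show ?case by (simp add: bit_0)
next
  case (Suc j)
  show ?case
  proof (cases "even x")
    case True
    then obtain y where y: "x = 2 * y" by (rule evenE)
    have "(x - 1) div 2 = y - 1" "x div 2 = y" by (simp_all add: y)
    moreover have "2 ^ Suc j dvd x \<longleftrightarrow> 2 ^ j dvd y" by (simp add: y)
    ultimately show ?thesis using Suc[of y] by (simp only: bit_Suc)
  next
    case False
    then have "\<not> 2 ^ Suc j dvd x" by (metis dvd_trans dvd_triv_left power_Suc)
    moreover have "(x - 1) div 2 = x div 2" using False by presburger
    ultimately show ?thesis by (simp only: bit_Suc) blast
  qed
qed

lemma power_Suc_dvd_iff: "2 ^ Suc j dvd (x :: int) \<longleftrightarrow> 2 ^ j dvd x \<and> \<not> bit x j"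
proof
  assume "2 ^ Suc j dvd x"
  then obtain y where "x = 2 ^ Suc j * y" by (rule dvdE)
  then have "x = 2 ^ j * (2 * y)" by simp
  then show "2 ^ j dvd x \<and> \<not> bit x j" by (simp add: bit_iff_odd)
next
  assume "2 ^ j dvd x \<and> \<not> bit x j"
  then obtain y where "x = 2 ^ j * y" "\<not> bit x j" by blast
  then have "even y" by (simp add: bit_iff_odd)
  then show "2 ^ Suc j dvd x" using \<open>x = 2 ^ j * y\<close> by auto
qed

lemma bit_minus_succ: "bit (- x - 1 :: int) j \<longleftrightarrow> \<not> bit x j"
  using bit_not_int_iff[of x j] by (simp add: not_int_def)

lemma dvd_minus_succ: "k dvd (- x - 1 :: int) \<longleftrightarrow> k dvd x + 1"
proof -
  have "- x - 1 = - (x + 1)" by simp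
  then show ?thesis by (simp only: dvd_minus_iff)
qed

text \<open>\<open>- x - 1\<close> is the bitwise complement of \<open>x\<close>, so adding one to
  \<open>x\<close> is subtracting one from its complement, and the increment reduces to the
  borrow.\<close>

lemma bit_upd: "bit (upd op x) j \<longleftrightarrow> (bit x j \<noteq> carry op j x)"
proof (cases "op = OffInc")
  case True
  have e: "- x - 1 - 1 = - (x + 1) - 1" by simp
  have "bit (x + 1) j \<longleftrightarrow> \<not> bit (- x - 1 - 1) j"
    unfolding e using bit_minus_succ[of "x + 1" j] by blast
  then show ?thesis
    using True unfolding bit_pred[of "- x - 1" j] bit_minus_succ[of x j] dvd_minus_succ
    by (auto simp: carry_def flips_def)
next
  case False
  then show ?thesis using bit_pred[of x j] by (cases op) (auto simp: carry_def flips_def)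
qed

lemma carry_Suc: "carry op (Suc j) x \<longleftrightarrow> carry op j x \<and> bit x j = flips op"
proof (cases "flips op")
  case True
  then show ?thesis
    using power_Suc_dvd_iff[of j "- x - 1"] unfolding bit_minus_succ[of x j] dvd_minus_succ
    by (simp add: carry_def del: power_Suc)
next
  case False
  then show ?thesis using power_Suc_dvd_iff[of j x] by (simp add: carry_def del: power_Suc)
qed

lemma dvd_succ_iff: "0 \<le> (x :: int) \<Longrightarrow> x < k \<Longrightarrow> k dvd x + 1 \<longleftrightarrow> x = k - 1"
  using zdvd_imp_le[of k "x + 1"] by auto

lemma bit_mod_power: "j < m \<Longrightarrow> bit (x mod 2 ^ m :: int) j = bit x j"
  by (simp add: take_bit_eq_mod[symmetric] bit_take_bit_iff)


section \<open>The TBox\<close>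

text \<open>Without negation, each bit, flag and carry needs one concept name per truth value.
  \<open>CarryEndF\<close> is an index-free copy of the carry at position \<open>m\<close>, for use
  in rules that do not depend on \<open>m\<close>.\<close>

datatype 'v family =
    BitF bool bool
  | FlagF bool bool
  | CarryF counter_op bool
  | CarryEndF counter_op bool
  | PosF
  | BigF
  | ValF 'v
  | ActF nat
  | SuccF

instance family :: (countable) countable by countable_datatype

text \<open>The \<open>Box Star\<close> on the right makes the conclusion global: facts about nodes
  hold in all precisifications, whereas flags, activity and successor marks stay local to one
  edge.\<close>

definition imp :: "('c, 'r, 'i, 's) cterm \<Rightarrow> 'c \<Rightarrow> ('c, 'r, 'i, 's) gci" where
  "imp C A = GCI (Box Star) C (Modal (Box Star) (Atom A))"

text \<open>The nominal forces the existential witness to be the one element that every node can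
  reach, so the flag lands there, in the current precisification. The empty word is the only role
  name and the only individual name in use.\<close>

definition push :: "('c, name, name, 's) cterm \<Rightarrow> 'c \<Rightarrow> ('c, name, name, 's) gci" where
  "push C A = GCI (Box Star) C (Ex [] (And (Nominal []) (Atom A)))"

text \<open>An atom \<open>(F, k, u)\<close> of a template stands for \<open>(F, k)\<close>, or for \<open>(F, k + j)\<close> with the
  index \<open>j\<close> of the instance if \<open>u\<close> holds.\<close>

type_synonym 'v tcterm = "('v family \<times> nat \<times> bool, name, name, name) cterm"
type_synonym 'v tgci = "('v family \<times> nat \<times> bool, name, name, name) gci"
type_synonym 'v acterm = "('v family \<times> nat, name, name, name) cterm"
type_synonym 'v agci = "('v family \<times> nat, name, name, name) gci"

definition index :: "nat \<Rightarrow> 'v family \<times> nat \<times> bool \<Rightarrow> 'v family \<times> nat" where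
  "index j = (\<lambda>(F, k, u). (F, k + (if u then j else 0)))"

definition inst :: "nat \<Rightarrow> 'v tgci list \<Rightarrow> 'v agci list" where
  "inst j = map (map_gci (index j) id id id)"

abbreviation fixd :: "'v family \<Rightarrow> 'v tcterm" where "fixd F \<equiv> Atom (F, 0, False)"
abbreviation here :: "'v family \<Rightarrow> 'v tcterm" where "here F \<equiv> Atom (F, 0, True)"

text \<open>Reads a fact of child \<open>c\<close> from any precisification. \<open>SuccF\<close> is
  needed to single out the child, since the nominal is always a successor as well.\<close>

definition up :: "nat \<Rightarrow> 'v family \<times> nat \<times> bool \<Rightarrow> 'v tcterm" where
  "up c A = Modal (Dia Star) (And (fixd (ActF c)) (Ex [] (And (fixd SuccF) (Atom A))))"

definition ops :: "counter_op list" where "ops = [TimeDec, OffDec, OffInc]"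
definition bools :: "bool list" where "bools = [False, True]"

text \<open>A node is a time and an offset, stored bitwise in the registers \<open>True\<close> and \<open>False\<close>.
  Its five children are one step earlier, at the offsets one less, equal, one more, \<open>0\<close> and \<open>-1\<close>.\<close>

definition child_ops :: "(nat \<times> counter_op) list" where
  "child_ops = [(0, TimeDec), (1, TimeDec), (2, TimeDec), (3, TimeDec), (4, TimeDec),
     (0, OffDec), (2, OffInc)]"

definition reg_of :: "counter_op \<Rightarrow> bool" where "reg_of op \<longleftrightarrow> op = TimeDec"

text \<open>A bit of the child differs from the bit of the node exactly where there is a carry,
  hence the posted value \<open>b \<noteq> k\<close>. The last two rules give the root time -1 and
  offset 0.\<close>

definition bit_gcis :: "'v tgci list" where
  "bit_gcis =
     concat (map (\<lambda>op.
       [imp (And (here (CarryF op True)) (here (BitF (reg_of op) (flips op)))) (CarryF op True, 1, True),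
        imp (And (here (CarryF op True)) (here (BitF (reg_of op) (\<not> flips op)))) (CarryF op False, 1, True),
        imp (here (CarryF op False)) (CarryF op False, 1, True)]) ops) @
     concat (map (\<lambda>(c, op). concat (map (\<lambda>k. map (\<lambda>b.
       push (And (fixd (ActF c)) (And (here (CarryF op k)) (here (BitF (reg_of op) b))))
         (FlagF (reg_of op) (b \<noteq> k), 0, True)) bools) bools)) child_ops) @
     map (\<lambda>b. push (And (fixd (ActF 1)) (here (BitF False b))) (FlagF False b, 0, True)) bools @
     [push (fixd (ActF 3)) (FlagF False False, 0, True), push (fixd (ActF 4)) (FlagF False True, 0, True)] @
     concat (map (\<lambda>r. map (\<lambda>b.
       imp (And (fixd SuccF) (Ex [] (And (Nominal []) (here (FlagF r b))))) (BitF r b, 0, True)) bools) bools) @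
     [imp (Nominal []) (BitF True True, 0, True), imp (Nominal []) (BitF False False, 0, True)]"

definition end_gcis :: "'v tgci list" where
  "end_gcis = concat (map (\<lambda>op. map (\<lambda>k. imp (here (CarryF op k)) (CarryEndF op k, 0, False)) bools) ops)"

text \<open>Kept apart because its index is the input length: the first offset beyond the input
  becomes large here, and a constant rule passes largeness on to the following offsets.\<close>

definition big_gcis :: "'v tgci list" where
  "big_gcis = [imp (And (fixd (CarryEndF OffDec False)) (up 0 (PosF, 0, True))) (BigF, 0, False)]"

text \<open>Turing machines are abstracted to finitely many local values with a rule computing a
  value from five earlier ones. \<open>v_out\<close> is the initial value at offset -1;
  \<open>bad\<close> marks the values forbidden at the root.\<close>

locale tableau =
  fixes vals :: "'v list" and step :: "'v \<Rightarrow> 'v \<Rightarrow> 'v \<Rightarrow> 'v \<Rightarrow> 'v \<Rightarrow> 'v"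
    and v_start :: 'v and v_bit :: "bool \<Rightarrow> 'v" and v_blank :: 'v and v_out :: 'v
    and bad :: "'v \<Rightarrow> bool"
begin

text \<open>The first rule links every element to the nominal, which is how children get to see the
  posted flags. Final carries act as tests: \<open>TimeDec\<close> for time 0, \<open>OffDec\<close>
  for offset 0, \<open>OffInc\<close> for offset -1.\<close>

definition const_gcis :: "'v tgci list" where
  "const_gcis =
     GCI (Box Star) Top (Ex [] (Nominal [])) #
     map (\<lambda>c. GCI (Box Star) Top (Modal (Dia Star) (And (fixd (ActF c)) (Ex [] (fixd SuccF))))) [0, 1, 2, 3, 4] @
     map (\<lambda>op. imp Top (CarryF op True, 0, False)) ops @
     [imp (fixd (CarryEndF OffDec True)) (PosF, 0, False),
      imp (And (fixd (CarryEndF OffDec False)) (up 0 (BigF, 0, False))) (BigF, 0, False),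
      imp (And (fixd (CarryEndF TimeDec True)) (fixd PosF)) (ValF v_start, 0, False),
      imp (And (fixd (CarryEndF TimeDec True)) (And (fixd BigF) (fixd (CarryEndF OffInc False))))
        (ValF v_blank, 0, False),
      imp (And (fixd (CarryEndF TimeDec True)) (fixd (CarryEndF OffInc True))) (ValF v_out, 0, False)] @
     concat (map (\<lambda>v0. concat (map (\<lambda>v1. concat (map (\<lambda>v2. concat (map (\<lambda>v3. map (\<lambda>v4.
       imp (And (fixd (CarryEndF TimeDec False))
         (And (up 0 (ValF v0, 0, False)) (And (up 1 (ValF v1, 0, False)) (And (up 2 (ValF v2, 0, False))
           (And (up 3 (ValF v3, 0, False)) (up 4 (ValF v4, 0, False)))))))
         (ValF (step v0 v1 v2 v3 v4), 0, False)) vals) vals)) vals)) vals)) vals) @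
     map (\<lambda>v. GCI (Box Star) (And (Nominal []) (fixd (ValF v))) Bot) (filter bad vals)"

definition input_gcis :: "bool \<Rightarrow> 'v tgci list" where
  "input_gcis b =
     [imp (And (fixd (CarryEndF OffDec False)) (up 0 (PosF, 0, True))) (PosF, 1, True),
      imp (And (fixd (CarryEndF TimeDec True)) (Atom (PosF, 1, True))) (ValF (v_bit b), 0, False)]"

text \<open>The blocks are ordered so that the indices 0, then 0 to n - 1, then n, then 0 to m - 1,
  then m can be produced in one pass by counters that only count up.\<close>

definition tbox :: "bool list \<Rightarrow> nat \<Rightarrow> 'v agci list" where
  "tbox w m = inst 0 const_gcis @ concat (map (\<lambda>j. inst j (input_gcis (w ! j))) [0..<length w]) @
     inst (length w) big_gcis @ concat (map (\<lambda>j. inst j bit_gcis) [0..<m]) @ inst m end_gcis"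

end

locale tableau_run = tableau vals step v_start v_bit v_blank v_out bad
  for vals :: "'v list" and step v_start v_bit v_blank v_out bad +
  fixes w :: "bool list" and m :: nat and val :: "nat \<Rightarrow> int \<Rightarrow> 'v"
  assumes size: "length w + 2 \<le> 2 ^ m"
    and val_vals: "\<And>t d. t < 2 ^ m \<Longrightarrow> val t d \<in> set vals"
    and val_mod: "\<And>t d. t < 2 ^ m \<Longrightarrow> val t (d mod 2 ^ m) = val t d"
    and val_0: "\<And>d. 0 \<le> d \<Longrightarrow> d < 2 ^ m \<Longrightarrow> val 0 d =
        (if d = 0 then v_start else if d \<le> int (length w) then v_bit (w ! (nat d - 1))
         else if d = 2 ^ m - 1 then v_out else v_blank)"
    and val_Suc: "\<And>t d. Suc t < 2 ^ m \<Longrightarrow> val (Suc t) d =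
        step (val t (d - 1)) (val t d) (val t (d + 1)) (val t 0) (val t (- 1))"

definition child_off :: "nat \<Rightarrow> int \<Rightarrow> int" where
  "child_off c d = [d - 1, d, d + 1, 0, - 1] ! c"

section \<open>Satisfaction of template instances\<close>

definition sat_all :: "('c, 'r, 'i, 's, 'd, 'p) sp_struct \<Rightarrow> ('c, 'r, 'i, 's) gci list \<Rightarrow> bool" where
  "sat_all S gs \<longleftrightarrow> (\<forall>g\<in>set gs. sat_gci S g)"

lemma sat_all_simps [simp]:
  "sat_all S []" "sat_all S (g # gs) \<longleftrightarrow> sat_gci S g \<and> sat_all S gs"
  "sat_all S (gs @ hs) \<longleftrightarrow> sat_all S gs \<and> sat_all S hs"
  "sat_all S (concat gss) \<longleftrightarrow> (\<forall>gs\<in>set gss. sat_all S gs)"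
  by (auto simp: sat_all_def)

lemma inst_simps [simp]:
  "inst j [] = []" "inst j (g # gs) = map_gci (index j) id id id g # inst j gs"
  "inst j (gs @ hs) = inst j gs @ inst j hs" "inst j (concat gss) = concat (map (inst j) gss)"
  by (auto simp: inst_def map_concat)

lemma sat_all_inst_map [simp]:
  "sat_all S (inst j (map f xs)) \<longleftrightarrow> (\<forall>x\<in>set xs. sat_gci S (map_gci (index j) id id id (f x)))"
  by (auto simp: sat_all_def inst_def)

lemma map_gci_simps [simp]:
  "map_gci f id id id (imp C A) = imp (map_cterm f id id id C) (f A)"
  "map_gci f id id id (push C A) = push (map_cterm f id id id C) (f A)"
  by (simp_all add: imp_def push_def)

definition rigid :: "('c, 'r, 'i, 's, 'd, 'p) sp_struct \<Rightarrow> 'c \<Rightarrow> 'd \<Rightarrow> bool" where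
  "rigid S A x \<longleftrightarrow> (\<forall>\<pi>\<in>Prec S. x \<in> conc_int (gamma S \<pi>) A)"

lemma sat_imp:
  assumes "standpoint_structure S"
  shows "sat_gci S (imp C A) \<longleftrightarrow> (\<forall>\<pi>\<in>Prec S. \<forall>x\<in>ext S \<pi> C. rigid S A x)"
  using standpoint_structureD(7)[OF assms] by (auto simp: imp_def rigid_def)

lemma sat_push:
  assumes "standpoint_structure S"
  shows "sat_gci S (push C A) \<longleftrightarrow> (\<forall>\<pi>\<in>Prec S. \<forall>x\<in>ext S \<pi> C.
     ind_int (gamma S \<pi>) [] \<in> conc_int (gamma S \<pi>) A \<and>
     (x, ind_int (gamma S \<pi>) []) \<in> role_int (gamma S \<pi>) [])"
  using standpoint_structureD(7)[OF assms] by (auto simp: push_def)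

lemma index_simps [simp]: "index j (F, k, True) = (F, k + j)" "index j (F, k, False) = (F, k)"
  by (simp_all add: index_def)

definition aup :: "nat \<Rightarrow> 'v family \<times> nat \<Rightarrow> 'v acterm" where
  "aup c A = Modal (Dia Star) (And (Atom (ActF c, 0)) (Ex [] (And (Atom (SuccF, 0)) (Atom A))))"

lemma map_up [simp]: "map_cterm (index j) id id id (up c A) = aup c (index j A)"
  by (simp add: up_def aup_def)

lemma sets_ops [simp]: "set ops = UNIV" "set bools = UNIV"
  by (auto simp: ops_def bools_def intro: counter_op.exhaust)

context tableau_run
begin

subsection \<open>From a model to the run\<close>

context
  fixes S :: "('v family \<times> nat, name, name, name, 'd, 'p) sp_struct"
  assumes S: "standpoint_structure S" and sat: "sat_all S (tbox w m)"
begin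

lemma S_const: "sat_all S (inst 0 const_gcis)"
  and S_input: "j < length w \<Longrightarrow> sat_all S (inst j (input_gcis (w ! j)))"
  and S_big: "sat_all S (inst (length w) big_gcis)"
  and S_bit: "j < m \<Longrightarrow> sat_all S (inst j bit_gcis)"
  and S_end: "sat_all S (inst m end_gcis)"
  using sat by (auto simp: tbox_def)

lemma Prec_ne: "\<exists>\<pi>. \<pi> \<in> Prec S"
  using standpoint_structureD(1,7)[OF S] by blast

lemma impD:
  "sat_gci S (imp C A) \<Longrightarrow> (\<And>\<pi>. \<pi> \<in> Prec S \<Longrightarrow> x \<in> ext S \<pi> C) \<Longrightarrow> rigid S A x"
  using Prec_ne by (auto simp: sat_imp[OF S])

text \<open>Times and offsets are integers of which only the lowest \<open>m\<close> bits matter. A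
  counter running below 0 thus needs no case distinction: \<open>t - 1\<close> is always a
  legitimate time of a child.\<close>

definition has_bits :: "'d \<Rightarrow> int \<Rightarrow> int \<Rightarrow> bool" where
  "has_bits x t d \<longleftrightarrow> x \<in> Delta S \<and>
     (\<forall>j<m. rigid S (BitF True (bit t j), j) x \<and> rigid S (BitF False (bit d j), j) x)"

definition reg :: "counter_op \<Rightarrow> int \<Rightarrow> int \<Rightarrow> int" where
  "reg op t d = (if reg_of op then t else d)"

lemma has_bits_reg: "has_bits x t d \<Longrightarrow> j < m \<Longrightarrow> rigid S (BitF (reg_of op) (bit (reg op t d) j), j) x"
  by (simp add: has_bits_def reg_def)

lemma rigid_carry:
  assumes x: "has_bits x t d" and "j \<le> m"
  shows "rigid S (CarryF op (carry op j (reg op t d)), j) x"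
  using assms(2)
proof (induction j)
  case 0
  have "sat_gci S (imp Top (CarryF op True, 0))"
    using S_const by (simp add: const_gcis_def)
  from impD[OF this, of x] show ?case using x by (simp add: has_bits_def carry_0)
next
  case (Suc j)
  have "sat_all S (inst j bit_gcis)" using S_bit Suc.prems by simp
  then have *: "sat_gci S (imp (And (Atom (CarryF op True, j)) (Atom (BitF (reg_of op) (flips op), j))) (CarryF op True, Suc j))"
    "sat_gci S (imp (And (Atom (CarryF op True, j)) (Atom (BitF (reg_of op) (\<not> flips op), j))) (CarryF op False, Suc j))"
    "sat_gci S (imp (Atom (CarryF op False, j)) (CarryF op False, Suc j))"
    by (simp_all add: bit_gcis_def)
  have "rigid S (BitF (reg_of op) (bit (reg op t d) j), j) x"
    using has_bits_reg[OF x] Suc.prems by simp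
  moreover have "rigid S (CarryF op (carry op j (reg op t d)), j) x" using Suc by simp
  moreover define k b where "k = carry op j (reg op t d)" and "b = bit (reg op t d) j"
  ultimately have kb: "rigid S (BitF (reg_of op) b, j) x" "rigid S (CarryF op k, j) x" by simp_all
  have "rigid S (CarryF op (k \<and> b = flips op), Suc j) x"
  proof (cases k)
    case True
    show ?thesis
    proof (cases "b = flips op")
      case b: True
      show ?thesis using impD[OF *(1), of x] kb True b by (simp add: rigid_def)
    next
      case False
      then have "b = (\<not> flips op)" by blast
      then show ?thesis using impD[OF *(2), of x] kb True by (simp add: rigid_def)
    qed
  next
    case False
    then show ?thesis using impD[OF *(3), of x] kb by (simp add: rigid_def)
  qed
  then show ?case by (simp add: carry_Suc k_def b_def)
qed

lemma rigid_carry_end: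
  "has_bits x t d \<Longrightarrow> rigid S (CarryEndF op (carry op m (reg op t d)), 0) x"
proof -
  assume "has_bits x t d"
  from rigid_carry[OF this order_refl]
  have *: "rigid S (CarryF op (carry op m (reg op t d)), m) x" .
  from S_end have "sat_gci S (imp (Atom (CarryF op k, m)) (CarryEndF op k, 0))" for k
    by (simp add: end_gcis_def)
  from impD[OF this] show ?thesis using * by (simp add: rigid_def)
qed

section \<open>Edges of the computation graph in an arbitrary model\<close>

lemma to_nominal:
  "\<pi> \<in> Prec S \<Longrightarrow> x \<in> Delta S \<Longrightarrow> (x, ind_int (gamma S \<pi>) []) \<in> role_int (gamma S \<pi>) []"
  using S_const standpoint_structureD(7)[OF S] by (auto simp: const_gcis_def)

lemma child_exists:
  assumes "x \<in> Delta S" "c < 5"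
  obtains \<pi> y where "\<pi> \<in> Prec S" "y \<in> Delta S" "x \<in> conc_int (gamma S \<pi>) (ActF c, 0)"
    "y \<in> conc_int (gamma S \<pi>) (SuccF, 0)" "(x, y) \<in> role_int (gamma S \<pi>) []"
proof -
  have "\<forall>c\<in>{0, 1, 2, 3, 4}. sat_gci S (GCI (Box Star) Top
      (Modal (Dia Star) (And (Atom (ActF c, 0)) (Ex [] (Atom (SuccF, 0))))))"
    using S_const by (simp add: const_gcis_def)
  moreover have "c \<in> {0, 1, 2, 3, 4}" using assms(2) by auto
  ultimately have "sat_gci S (GCI (Box Star) Top
      (Modal (Dia Star) (And (Atom (ActF c, 0)) (Ex [] (Atom (SuccF, 0))))))" by blast
  moreover obtain \<pi>0 where "\<pi>0 \<in> Prec S" using Prec_ne by blast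
  ultimately have "x \<in> ext S \<pi>0 (Modal (Dia Star) (And (Atom (ActF c, 0)) (Ex [] (Atom (SuccF, 0)))))"
    using assms(1) standpoint_structureD(7)[OF S] by simp blast
  then obtain \<pi> y where "\<pi> \<in> Prec S" "x \<in> conc_int (gamma S \<pi>) (ActF c, 0)"
    "y \<in> conc_int (gamma S \<pi>) (SuccF, 0)" "(x, y) \<in> role_int (gamma S \<pi>) []"
    using standpoint_structureD(7)[OF S] by auto
  then show thesis using that standpoint_structureD(3)[OF S] by blast
qed

text \<open>The blackboard at work: \<open>x\<close> places the flag on the nominal in
  \<open>\<pi>\<close>, and \<open>y\<close>, marked as successor in the same \<open>\<pi>\<close>
  and linked to the nominal, picks it up as a bit valid in all precisifications.\<close>

lemma transfer_bit:
  assumes "\<pi> \<in> Prec S" "y \<in> Delta S" "y \<in> conc_int (gamma S \<pi>) (SuccF, 0)" "j < m"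
    and "x \<in> ext S \<pi> C" "sat_gci S (push C (FlagF r b, j))"
  shows "rigid S (BitF r b, j) y"
proof -
  have "sat_gci S (imp (And (Atom (SuccF, 0)) (Ex [] (And (Nominal []) (Atom (FlagF r b, j))))) (BitF r b, j))"
    using S_bit[OF assms(4)] by (simp add: bit_gcis_def)
  moreover have "y \<in> ext S \<pi> (And (Atom (SuccF, 0)) (Ex [] (And (Nominal []) (Atom (FlagF r b, j)))))"
    using assms to_nominal[of \<pi> y] by (auto simp: sat_push[OF S])
  ultimately show ?thesis using assms(1) by (auto simp: sat_imp[OF S])
qed

text \<open>All five labels post the decremented time; they differ only in the source of the offset
  bits. What is rigid at \<open>y\<close> holds in particular in the precisification of the edge, so
  \<open>x\<close> sees it from everywhere through \<open>Dia Star\<close>.\<close>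

lemma child:
  assumes x: "has_bits x t d" and c: "c < 5"
  obtains y where "has_bits y (t - 1) (child_off c d)"
    "\<And>A \<pi>. rigid S A y \<Longrightarrow> \<pi> \<in> Prec S \<Longrightarrow> x \<in> ext S \<pi> (aup c A)"
proof -
  have xD: "x \<in> Delta S" using x by (simp add: has_bits_def)
  obtain \<pi> y where y: "\<pi> \<in> Prec S" "y \<in> Delta S" "x \<in> conc_int (gamma S \<pi>) (ActF c, 0)"
    "y \<in> conc_int (gamma S \<pi>) (SuccF, 0)" "(x, y) \<in> role_int (gamma S \<pi>) []"
    using child_exists[OF xD c] .
  note transfer = transfer_bit[OF y(1,2,4)]
  have upd: "rigid S (BitF (reg_of op) (bit (upd op (reg op t d)) j), j) y"
    if "(c, op) \<in> set child_ops" "j < m" for op j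
  proof -
    let ?k = "carry op j (reg op t d)" and ?b = "bit (reg op t d) j"
    have "rigid S (CarryF op ?k, j) x" "rigid S (BitF (reg_of op) ?b, j) x"
      using rigid_carry[OF x] has_bits_reg[OF x] that(2) by simp_all
    then have "x \<in> ext S \<pi> (And (Atom (ActF c, 0)) (And (Atom (CarryF op ?k, j)) (Atom (BitF (reg_of op) ?b, j))))"
      using y by (simp add: rigid_def)
    moreover have "\<forall>(c, op)\<in>set child_ops. \<forall>k b. sat_gci S (push (And (Atom (ActF c, 0))
        (And (Atom (CarryF op k, j)) (Atom (BitF (reg_of op) b, j)))) (FlagF (reg_of op) (b \<noteq> k), j))"
      using S_bit[OF that(2)] by (simp add: bit_gcis_def split_beta)
    then have "sat_gci S (push (And (Atom (ActF c, 0))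
        (And (Atom (CarryF op ?k, j)) (Atom (BitF (reg_of op) ?b, j)))) (FlagF (reg_of op) (?b \<noteq> ?k), j))"
      using that(1) by blast
    ultimately have "rigid S (BitF (reg_of op) (?b \<noteq> ?k), j) y"
      using transfer[OF that(2)] by blast
    then show ?thesis by (simp add: bit_upd)
  qed
  have "rigid S (BitF True (bit (t - 1) j), j) y" if "j < m" for j
  proof -
    have "(c, TimeDec) \<in> set child_ops" using c by (auto simp: child_ops_def)
    from upd[OF this that] show ?thesis by (simp add: reg_def reg_of_def)
  qed
  moreover have "rigid S (BitF False (bit (child_off c d) j), j) y" if "j < m" for j
  proof -
    have "c = 0 \<or> c = 1 \<or> c = 2 \<or> c = 3 \<or> c = 4" using c by auto
    then consider "c = 0" | "c = 1" | "c = 2" | "c = 3" | "c = 4" by blast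
    then show ?thesis
    proof cases
      case 1
      then show ?thesis using upd[of OffDec, OF _ that]
        by (simp add: child_ops_def reg_def reg_of_def child_off_def)
    next
      case 2
      have "rigid S (BitF False (bit d j), j) x" using x that by (simp add: has_bits_def)
      moreover have "sat_gci S (push (And (Atom (ActF 1, 0)) (Atom (BitF False b, j))) (FlagF False b, j))" for b
        using S_bit[OF that] by (simp add: bit_gcis_def)
      ultimately show ?thesis using 2 y
        by (intro transfer[OF that, of x "And (Atom (ActF 1, 0)) (Atom (BitF False (bit d j), j))"])
          (auto simp: child_off_def rigid_def)
    next
      case 3
      then show ?thesis using upd[of OffInc, OF _ that]
        by (simp add: child_ops_def reg_def reg_of_def child_off_def)
    next
      case 4
      have "sat_gci S (push (Atom (ActF 3, 0)) (FlagF False False, j))"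
        using S_bit[OF that] by (simp add: bit_gcis_def)
      then show ?thesis using 4 y
        by (intro transfer[OF that, of x "Atom (ActF 3, 0)"]) (auto simp: child_off_def)
    next
      case 5
      have "sat_gci S (push (Atom (ActF 4, 0)) (FlagF False True, j))"
        using S_bit[OF that] by (simp add: bit_gcis_def)
      then show ?thesis using 5 y
        by (intro transfer[OF that, of x "Atom (ActF 4, 0)"]) (auto simp: child_off_def bit_minus_1_iff)
    qed
  qed
  ultimately have "has_bits y (t - 1) (child_off c d)" using y(2) by (simp add: has_bits_def)
  moreover have "x \<in> ext S \<pi>' (aup c A)" if "rigid S A y" for A \<pi>'
    using y that standpoint_structureD(7)[OF S] by (auto simp: aup_def rigid_def)
  ultimately show thesis using that by blast
qed

text \<open>Counting in unary along the children labelled 0, whose offset is one less, down to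
  offset 0. The time is arbitrary because it drops along the way and may wrap below 0.\<close>

lemma position:
  "has_bits x t (int i) \<Longrightarrow> i < 2 ^ m \<Longrightarrow>
   (if i \<le> length w then rigid S (PosF, i) x else rigid S (BigF, 0) x)"
proof (induction i arbitrary: x t)
  case 0
  have "sat_gci S (imp (Atom (CarryEndF OffDec True, 0)) (PosF, 0))"
    using S_const by (simp add: const_gcis_def)
  moreover have "rigid S (CarryEndF OffDec True, 0) x"
    using rigid_carry_end[OF 0(1), of OffDec] by (simp add: reg_def reg_of_def carry_def flips_def)
  ultimately show ?case using impD[of "Atom (CarryEndF OffDec True, 0)" "(PosF, 0)" x]
    by (auto simp: rigid_def)
next
  case (Suc i)
  have "\<not> 2 ^ m dvd int (Suc i)"
    using Suc.prems(2) by (metis nat_dvd_not_less of_nat_dvd_iff of_nat_numeral of_nat_power zero_less_Suc)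
  then have c: "rigid S (CarryEndF OffDec False, 0) x"
    using rigid_carry_end[OF Suc.prems(1), of OffDec] by (simp add: reg_def reg_of_def carry_def flips_def)
  obtain y where y: "has_bits y (t - 1) (child_off 0 (int (Suc i)))"
    "\<And>A \<pi>. rigid S A y \<Longrightarrow> \<pi> \<in> Prec S \<Longrightarrow> x \<in> ext S \<pi> (aup 0 A)"
    using child[OF Suc.prems(1), of 0] by auto
  have IH: "if i \<le> length w then rigid S (PosF, i) y else rigid S (BigF, 0) y"
    using Suc.IH[of y] y(1) Suc.prems(2) by (simp add: child_off_def)
  have C: "\<pi> \<in> Prec S \<Longrightarrow> x \<in> ext S \<pi> (And (Atom (CarryEndF OffDec False, 0)) (aup 0 A))"
    if "rigid S A y" for A \<pi> using c y(2)[OF that] by (auto simp: rigid_def)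
  have input: "sat_gci S (imp (And (Atom (CarryEndF OffDec False, 0)) (aup 0 (PosF, i))) (PosF, Suc i))"
    if "i < length w" using S_input[OF that] by (simp add: input_gcis_def)
  have big: "sat_gci S (imp (And (Atom (CarryEndF OffDec False, 0)) (aup 0 (PosF, length w))) (BigF, 0))"
    "sat_gci S (imp (And (Atom (CarryEndF OffDec False, 0)) (aup 0 (BigF, 0))) (BigF, 0))"
    using S_big S_const by (simp_all add: big_gcis_def const_gcis_def)
  show ?case
    using IH C[of "(PosF, i)"] C[of "(BigF, 0)"] impD[OF input] impD[OF big(1)] impD[OF big(2)]
    by (cases "i = length w") (auto split: if_splits)
qed

section \<open>Values of nodes in an arbitrary model\<close>

lemma has_bits_mod: "has_bits x t d \<Longrightarrow> has_bits x t (d mod 2 ^ m)"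
  by (simp add: has_bits_def bit_mod_power)

lemma rigid_val_0:
  assumes hb: "has_bits x 0 d" and d: "0 \<le> d" "d < 2 ^ m"
  shows "rigid S (ValF (val 0 d), 0) x"
proof -
  have t: "rigid S (CarryEndF TimeDec True, 0) x"
    using rigid_carry_end[OF hb, of TimeDec] by (simp add: reg_def reg_of_def carry_def flips_def)
  obtain i where i: "d = int i" using d(1) by (rule zero_le_imp_eq_int[THEN exE])
  then have "i < 2 ^ m" using d(2) by simp
  with hb i have pos: "if i \<le> length w then rigid S (PosF, i) x else rigid S (BigF, 0) x"
    using position[of x 0 i] by simp
  have oi: "rigid S (CarryEndF OffInc (d = 2 ^ m - 1), 0) x"
    using rigid_carry_end[OF hb, of OffInc] dvd_succ_iff[OF d]
    by (simp add: reg_def reg_of_def carry_def flips_def)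
  have R: "sat_gci S (imp (And (Atom (CarryEndF TimeDec True, 0)) (Atom (PosF, 0))) (ValF v_start, 0))"
    "sat_gci S (imp (And (Atom (CarryEndF TimeDec True, 0)) (And (Atom (BigF, 0)) (Atom (CarryEndF OffInc False, 0)))) (ValF v_blank, 0))"
    "sat_gci S (imp (And (Atom (CarryEndF TimeDec True, 0)) (Atom (CarryEndF OffInc True, 0))) (ValF v_out, 0))"
    using S_const by (simp_all add: const_gcis_def)
  have I: "sat_gci S (imp (And (Atom (CarryEndF TimeDec True, 0)) (Atom (PosF, Suc i))) (ValF (v_bit (w ! i)), 0))"
    if "i < length w" for i using S_input[OF that] by (simp add: input_gcis_def)
  consider "i = 0" | k where "i = Suc k" "k < length w" | "length w < i" "d = 2 ^ m - 1"
    | "length w < i" "d \<noteq> 2 ^ m - 1" by (cases i) force+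
  then show ?thesis
  proof cases
    case 1
    then have "val 0 d = v_start" using val_0[OF d] i by simp
    moreover have "rigid S (PosF, 0) x" using pos 1 by simp
    ultimately show ?thesis using t impD[OF R(1), of x] by (simp add: rigid_def)
  next
    case (2 k)
    then have "nat d - 1 = k" using i by simp
    then have "val 0 d = v_bit (w ! k)" using val_0[OF d] i 2 by simp
    moreover have "rigid S (PosF, Suc k) x" using pos 2 by simp
    ultimately show ?thesis using t impD[OF I[OF 2(2)], of x] by (simp add: rigid_def)
  next
    case 3
    then have "val 0 d = v_out" using val_0[OF d] i by auto
    then show ?thesis using oi 3 t impD[OF R(3), of x] by (simp add: rigid_def)
  next
    case 4
    then have "val 0 d = v_blank" using val_0[OF d] i by auto
    moreover have "rigid S (BigF, 0) x" using pos 4 by simp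
    ultimately show ?thesis using oi 4 t impD[OF R(2), of x] by (simp add: rigid_def)
  qed
qed

text \<open>Induction on time for all offsets at once: the children have their values by hypothesis,
  and the rule for this combination exists because the five values lie in
  \<open>vals\<close>.\<close>

lemma rigid_val:
  "has_bits x (int t) d \<Longrightarrow> t < 2 ^ m \<Longrightarrow> rigid S (ValF (val t d), 0) x"
proof (induction t arbitrary: x d)
  case 0
  \<comment> \<open>The offset may have left the range of residues on the way down; it is brought
    back before the initial values are compared.\<close>
  have "rigid S (ValF (val 0 (d mod 2 ^ m)), 0) x"
    using has_bits_mod[OF 0(1)] by (intro rigid_val_0) simp_all
  then show ?case using val_mod[OF 0(2), of d] by simp
next
  case (Suc t)
  have t: "\<not> 2 ^ m dvd int (Suc t)"
    using Suc.prems(2) by (metis nat_dvd_not_less of_nat_dvd_iff of_nat_numeral of_nat_power zero_less_Suc)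
  have c: "rigid S (CarryEndF TimeDec False, 0) x"
    using rigid_carry_end[OF Suc.prems(1), of TimeDec] t by (simp add: reg_def reg_of_def carry_def flips_def)
  have up: "x \<in> ext S \<pi> (aup c (ValF (val t (child_off c d)), 0))" if c5: "c < 5" and \<pi>: "\<pi> \<in> Prec S" for c \<pi>
  proof -
    obtain y where y: "has_bits y (int (Suc t) - 1) (child_off c d)"
      "\<And>A \<pi>. rigid S A y \<Longrightarrow> \<pi> \<in> Prec S \<Longrightarrow> x \<in> ext S \<pi> (aup c A)"
      using child[OF Suc.prems(1) c5] by auto
    then show ?thesis using Suc.IH[of y "child_off c d"] Suc.prems(2) \<pi> by simp
  qed
  have V: "val t d \<in> set vals" for d using val_vals Suc.prems(2) by simp
  have "\<forall>v0\<in>set vals. \<forall>v1\<in>set vals. \<forall>v2\<in>set vals. \<forall>v3\<in>set vals. \<forall>v4\<in>set vals.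
     sat_gci S (imp (And (Atom (CarryEndF TimeDec False, 0))
         (And (aup 0 (ValF v0, 0)) (And (aup 1 (ValF v1, 0)) (And (aup 2 (ValF v2, 0))
           (And (aup 3 (ValF v3, 0)) (aup 4 (ValF v4, 0))))))) (ValF (step v0 v1 v2 v3 v4), 0))"
    using S_const by (simp add: const_gcis_def)
  then have "sat_gci S (imp (And (Atom (CarryEndF TimeDec False, 0))
         (And (aup 0 (ValF (val t (d - 1)), 0)) (And (aup 1 (ValF (val t d), 0)) (And (aup 2 (ValF (val t (d + 1)), 0))
           (And (aup 3 (ValF (val t 0), 0)) (aup 4 (ValF (val t (- 1)), 0))))))) (ValF (val (Suc t) d), 0))"
    unfolding val_Suc[OF Suc.prems(2)] using V by blast
  then show ?case
  proof (rule impD)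
    fix \<pi> assume \<pi>: "\<pi> \<in> Prec S"
    have "x \<in> conc_int (gamma S \<pi>) (CarryEndF TimeDec False, 0)" using c \<pi> by (simp add: rigid_def)
    moreover have off: "child_off 0 d = d - 1" "child_off 1 d = d" "child_off 2 d = d + 1"
      "child_off 3 d = 0" "child_off 4 d = - 1"
      by (simp_all add: child_off_def)
    ultimately show "x \<in> ext S \<pi> (And (Atom (CarryEndF TimeDec False, 0))
         (And (aup 0 (ValF (val t (d - 1)), 0)) (And (aup 1 (ValF (val t d), 0)) (And (aup 2 (ValF (val t (d + 1)), 0))
           (And (aup 3 (ValF (val t 0), 0)) (aup 4 (ValF (val t (- 1)), 0)))))))"
      using up[OF _ \<pi>, of 0] up[OF _ \<pi>, of 1] up[OF _ \<pi>, of 2] up[OF _ \<pi>, of 3] up[OF _ \<pi>, of 4]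
      unfolding off by simp
  qed
qed

lemma not_bad: "\<not> bad (val (2 ^ m - 1) 0)"
proof
  assume bad: "bad (val (2 ^ m - 1) 0)"
  obtain \<pi> where \<pi>: "\<pi> \<in> Prec S" using Prec_ne by blast
  let ?o = "ind_int (gamma S \<pi>) []"
  have o: "\<pi>' \<in> Prec S \<Longrightarrow> ind_int (gamma S \<pi>') [] = ?o" for \<pi>'
    using standpoint_structureD(8)[OF S _ \<pi>] .
  have "rigid S (BitF True True, j) ?o \<and> rigid S (BitF False False, j) ?o" if "j < m" for j
  proof -
    have *: "sat_gci S (imp (Nominal []) (BitF True True, j))"
      "sat_gci S (imp (Nominal []) (BitF False False, j))"
      using S_bit[OF that] by (simp_all add: bit_gcis_def)
    show ?thesis using impD[OF *(1), of ?o] impD[OF *(2), of ?o] o by simp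
  qed
  moreover have "bit (2 ^ m - 1 :: int) j" if "j < m" for j
    using that by (simp add: mask_eq_exp_minus_1[symmetric] bit_mask_iff)
  moreover have "int (2 ^ m - 1) = 2 ^ m - 1" by (simp add: of_nat_diff)
  ultimately have "has_bits ?o (int (2 ^ m - 1)) 0"
    using standpoint_structureD(5)[OF S \<pi>] unfolding has_bits_def by simp
  then have "rigid S (ValF (val (2 ^ m - 1) 0), 0) ?o" by (rule rigid_val) simp
  moreover have "val (2 ^ m - 1) 0 \<in> set vals" by (simp add: val_vals)
  then have "sat_gci S (GCI (Box Star) (And (Nominal []) (Atom (ValF (val (2 ^ m - 1) 0), 0))) Bot)"
    using S_const bad by (auto simp: const_gcis_def)
  then have "ext S \<pi> (And (Nominal []) (Atom (ValF (val (2 ^ m - 1) 0), 0))) = {}"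
    using \<pi> standpoint_structureD(7)[OF S] by simp
  ultimately show False using \<pi> by (simp add: rigid_def)
qed

end

subsection \<open>From the run to a model\<close>

abbreviation reg_at :: "bool \<Rightarrow> int \<times> int \<Rightarrow> int" where
  "reg_at r x \<equiv> (if r then fst x else snd x)"

definition child_node :: "nat \<Rightarrow> int \<times> int \<Rightarrow> int \<times> int" where
  "child_node c x = (fst x - 1, child_off c (snd x))"

text \<open>Precisifications are the edges of the computation graph, given by a node and a child label.\<close>

fun conc :: "(int \<times> int) \<times> nat \<Rightarrow> 'v family \<times> nat \<Rightarrow> (int \<times> int) set" where
  "conc (y, c) (BitF r b, j) = {x. bit (reg_at r x) j = b}"
| "conc (y, c) (FlagF r b, j) = {x. x = (- 1, 0) \<and> bit (reg_at r (child_node c y)) j = b}"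
| "conc (y, c) (CarryF op b, j) = {x. carry op j (reg_at (reg_of op) x) = b}"
| "conc (y, c) (CarryEndF op b, j) = {x. carry op m (reg_at (reg_of op) x) = b}"
| "conc (y, c) (PosF, j) = {x. snd x mod 2 ^ m = int j}"
| "conc (y, c) (BigF, j) = {x. int (length w) < snd x mod 2 ^ m}"
| "conc (y, c) (ValF v, j) = {x. val (nat (fst x mod 2 ^ m)) (snd x) = v}"
| "conc (y, c) (ActF c', j) = {x. x = y \<and> c = c'}"
| "conc (y, c) (SuccF, j) = {child_node c y}"

text \<open>On the whole integer plane every child exists outright, and wrap-around enters only when
  concepts are evaluated modulo 2 ^ m. The role is universal everywhere, so selecting the child is
  left to \<open>ActF\<close> and \<open>SuccF\<close>. The nominal \<open>(- 1, 0)\<close> is the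
  root. Labels from 5 on have an unspecified child, which is harmless since the flags always
  describe the child, whatever it is.\<close>

definition canon :: "('v family \<times> nat, name, name, name, int \<times> int, (int \<times> int) \<times> nat) sp_struct" where
  "canon = \<lparr>Delta = UNIV, Prec = UNIV, sigma = \<lambda>_. UNIV,
     gamma = \<lambda>\<pi>. \<lparr>conc_int = conc \<pi>, role_int = \<lambda>_. UNIV, ind_int = \<lambda>_. (- 1, 0)\<rparr>\<rparr>"

section \<open>The canonical structure satisfies the TBox\<close>

lemma canon_simps [simp]:
  "Delta canon = UNIV" "Prec canon = UNIV" "sigma canon s = UNIV"
  "conc_int (gamma canon \<pi>) = conc \<pi>" "role_int (gamma canon \<pi>) R = UNIV"
  "ind_int (gamma canon \<pi>) a = (- 1, 0)"
  by (simp_all add: canon_def)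

lemma canon: "standpoint_structure canon"
  by (simp add: standpoint_structure_def dl_interpretation_def)

lemma canon_imp:
  "sat_gci canon (imp C A) \<longleftrightarrow> (\<forall>\<pi> x. x \<in> ext canon \<pi> C \<longrightarrow> (\<forall>\<pi>'. x \<in> conc \<pi>' A))"
  by (simp add: sat_imp[OF canon] rigid_def Ball_def)

lemma canon_push:
  "sat_gci canon (push C A) \<longleftrightarrow> (\<forall>\<pi> x. x \<in> ext canon \<pi> C \<longrightarrow> (- 1, 0) \<in> conc \<pi> A)"
  by (simp add: sat_push[OF canon] Ball_def)

text \<open>Only in the precisification \<open>(x, c)\<close> is \<open>x\<close> active with label
  \<open>c\<close>, and there a single element is marked as successor. Hence the existential reading
  is exact.\<close>

lemma canon_aup: "x \<in> ext canon \<pi> (aup c A) \<longleftrightarrow> child_node c x \<in> conc (x, c) A"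
proof -
  have "x \<in> ext canon \<pi> (aup c A) \<longleftrightarrow>
      (\<exists>\<pi>'. x \<in> conc \<pi>' (ActF c, 0) \<and> (\<exists>z. z \<in> conc \<pi>' (SuccF, 0) \<and> z \<in> conc \<pi>' A))"
    by (simp add: aup_def Bex_def del: Collect_const)
  also have "\<dots> \<longleftrightarrow>
      (\<exists>y k. x \<in> conc (y, k) (ActF c, 0) \<and> (\<exists>z. z \<in> conc (y, k) (SuccF, 0) \<and> z \<in> conc (y, k) A))"
    by (metis surj_pair)
  finally show ?thesis by simp
qed

lemma reg_child_node:
  "(c, op) \<in> set child_ops \<Longrightarrow> reg_at (reg_of op) (child_node c y) = upd op (reg_at (reg_of op) y)"
  by (auto simp: child_ops_def reg_of_def child_node_def child_off_def)

text \<open>In the precisification \<open>(y, c)\<close> the nominal carries precisely the bits of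
  child \<open>c\<close> of \<open>y\<close>; only \<open>y\<close> is active and only that child
  reads. So nothing wrong is posted or transferred.\<close>

lemma canon_bit: "sat_all canon (inst j bit_gcis)"
proof -
  have "sat_gci canon (push (And (Atom (ActF c, 0))
      (And (Atom (CarryF op k, j)) (Atom (BitF (reg_of op) b, j)))) (FlagF (reg_of op) (b \<noteq> k), j))"
    if op: "(c, op) \<in> set child_ops" for c op k b
    unfolding canon_push
  proof (intro allI impI)
    fix \<pi> x
    assume "x \<in> ext canon \<pi> (And (Atom (ActF c, 0)) (And (Atom (CarryF op k, j)) (Atom (BitF (reg_of op) b, j))))"
    then have x: "\<pi> = (x, c)" "carry op j (reg_at (reg_of op) x) = k" "bit (reg_at (reg_of op) x) j = b"
      by (cases \<pi>; simp)+
    show "(- 1, 0) \<in> conc \<pi> (FlagF (reg_of op) (b \<noteq> k), j)"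
      unfolding x(1) conc.simps reg_child_node[OF op] bit_upd using x(2,3) by blast
  qed
  then have "\<forall>(c, op)\<in>set child_ops. \<forall>k b. sat_gci canon (push (And (Atom (ActF c, 0))
      (And (Atom (CarryF op k, j)) (Atom (BitF (reg_of op) b, j)))) (FlagF (reg_of op) (b \<noteq> k), j))"
    by blast
  moreover have "sat_gci canon (imp (And (Atom (CarryF op True, j)) (Atom (BitF (reg_of op) (flips op), j))) (CarryF op True, Suc j))"
    "sat_gci canon (imp (And (Atom (CarryF op True, j)) (Atom (BitF (reg_of op) (\<not> flips op), j))) (CarryF op False, Suc j))"
    "sat_gci canon (imp (Atom (CarryF op False, j)) (CarryF op False, Suc j))" for op
    unfolding canon_imp by (auto simp: carry_Suc)
  moreover have "sat_gci canon (push (And (Atom (ActF 1, 0)) (Atom (BitF False b, j))) (FlagF False b, j))"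
    "sat_gci canon (push (Atom (ActF 3, 0)) (FlagF False False, j))"
    "sat_gci canon (push (Atom (ActF 4, 0)) (FlagF False True, j))" for b
    unfolding canon_push by (auto simp: child_node_def child_off_def)
  moreover have "sat_gci canon (imp (And (Atom (SuccF, 0)) (Ex [] (And (Nominal []) (Atom (FlagF r b, j))))) (BitF r b, j))"
    "sat_gci canon (imp (Nominal []) (BitF True True, j))"
    "sat_gci canon (imp (Nominal []) (BitF False False, j))" for r b
    unfolding canon_imp by auto
  ultimately show ?thesis by (simp add: bit_gcis_def split_beta)
qed

lemma canon_end: "sat_all canon (inst m end_gcis)"
proof -
  have "sat_gci canon (imp (Atom (CarryF op k, m)) (CarryEndF op k, 0))" for op k
    unfolding canon_imp by auto
  then show ?thesis by (simp add: end_gcis_def)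
qed

lemma mod_pos:
  assumes "\<not> 2 ^ m dvd (x :: int)"
  shows "0 < x mod 2 ^ m" "x mod 2 ^ m < 2 ^ m"
proof -
  have "x mod 2 ^ m \<noteq> 0" using assms mod_0_imp_dvd by blast
  moreover have "0 \<le> x mod 2 ^ m" by simp
  ultimately show "0 < x mod 2 ^ m" by linarith
qed simp

lemma pred_mod:
  assumes "\<not> 2 ^ m dvd (x :: int)"
  shows "(x - 1) mod 2 ^ m = x mod 2 ^ m - 1"
proof -
  have "(x mod 2 ^ m - 1) mod 2 ^ m = x mod 2 ^ m - 1"
    using mod_pos[OF assms] by (intro mod_pos_pos_trivial; linarith)
  moreover have "(x - 1) mod 2 ^ m = (x mod 2 ^ m - 1) mod 2 ^ m" by (rule mod_diff_left_eq[symmetric])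
  ultimately show ?thesis by (simp only:)
qed

lemma canon_big: "sat_all canon (inst (length w) big_gcis)"
proof -
  have "sat_gci canon (imp (And (Atom (CarryEndF OffDec False, 0)) (aup 0 (PosF, length w))) (BigF, 0))"
    unfolding canon_imp
    by (auto simp: canon_aup reg_of_def carry_def flips_def child_node_def child_off_def pred_mod)
  then show ?thesis by (simp add: big_gcis_def)
qed

lemma canon_input:
  assumes "j < length w"
  shows "sat_all canon (inst j (input_gcis (w ! j)))"
proof -
  have "sat_gci canon (imp (And (Atom (CarryEndF OffDec False, 0)) (aup 0 (PosF, j))) (PosF, Suc j))"
    unfolding canon_imp
    by (auto simp: canon_aup reg_of_def carry_def flips_def child_node_def child_off_def pred_mod)
  moreover have "val 0 d = v_bit (w ! j)" if "d mod 2 ^ m = 1 + int j" for d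
  proof -
    have "nat (1 + int j) - 1 = j" by simp
    moreover have "1 + int j < 2 ^ m" using pos_mod_bound[of "2 ^ m" d] that by simp
    ultimately show ?thesis
      using val_mod[of 0 d] val_0[of "d mod 2 ^ m"] that assms by simp
  qed
  then have "sat_gci canon (imp (And (Atom (CarryEndF TimeDec True, 0)) (Atom (PosF, Suc j))) (ValF (v_bit (w ! j)), 0))"
    unfolding canon_imp by (auto simp: reg_of_def carry_def flips_def)
  ultimately show ?thesis by (simp add: input_gcis_def)
qed

lemma dvd_succ_mod_iff: "(2 :: int) ^ m dvd x + 1 \<longleftrightarrow> x mod 2 ^ m = 2 ^ m - 1"
proof -
  have "2 ^ m dvd x + 1 \<longleftrightarrow> 2 ^ m dvd x mod 2 ^ m + 1"
    by (simp add: dvd_eq_mod_eq_0 mod_add_left_eq)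
  then show ?thesis using dvd_succ_iff[of "x mod 2 ^ m" "2 ^ m"] by simp
qed

text \<open>A time not divisible by 2 ^ m has a residue \<open>Suc s\<close>, where \<open>s\<close>
  is the residue of the time of all children; thus the recursion for \<open>val\<close> never
  crosses the wrap-around.\<close>

lemma canon_step:
  "sat_gci canon (imp (And (Atom (CarryEndF TimeDec False, 0))
     (And (aup 0 (ValF v0, 0)) (And (aup 1 (ValF v1, 0)) (And (aup 2 (ValF v2, 0))
       (And (aup 3 (ValF v3, 0)) (aup 4 (ValF v4, 0))))))) (ValF (step v0 v1 v2 v3 v4), 0))"
proof -
  have "val (nat (t mod 2 ^ m)) d = step (val s (d - 1)) (val s d) (val s (d + 1)) (val s 0) (val s (- 1))"
    if t: "\<not> 2 ^ m dvd t" and s: "s = nat ((t - 1) mod 2 ^ m)" for t d s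
  proof -
    obtain k where k: "t mod 2 ^ m = int k"
      using mod_pos(1)[OF t] by (metis zero_le_imp_eq_int less_imp_le)
    have "0 < k" "k < 2 ^ m" using mod_pos[OF t] unfolding k by simp_all
    then have "nat (t mod 2 ^ m) = Suc s" "Suc s < 2 ^ m"
      unfolding s pred_mod[OF t] k by simp_all
    then show ?thesis using val_Suc[of s d] by simp
  qed
  note step = this
  show ?thesis unfolding canon_imp
  proof (intro allI impI)
    fix \<pi> \<pi>' x
    assume A: "x \<in> ext canon \<pi> (And (Atom (CarryEndF TimeDec False, 0))
      (And (aup 0 (ValF v0, 0)) (And (aup 1 (ValF v1, 0)) (And (aup 2 (ValF v2, 0))
         (And (aup 3 (ValF v3, 0)) (aup 4 (ValF v4, 0)))))))"
    obtain t d where x: "x = (t, d)" by (rule prod.exhaust)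
    define s where "s = nat ((t - 1) mod 2 ^ m)"
    have "x \<in> conc \<pi> (CarryEndF TimeDec False, 0)" using A by simp
    then have t: "\<not> 2 ^ m dvd t"
      by (cases \<pi>) (simp add: x reg_of_def carry_def flips_def)
    have "child_node 0 x \<in> conc (x, 0) (ValF v0, 0)" "child_node 1 x \<in> conc (x, 1) (ValF v1, 0)"
      "child_node 2 x \<in> conc (x, 2) (ValF v2, 0)" "child_node 3 x \<in> conc (x, 3) (ValF v3, 0)"
      "child_node 4 x \<in> conc (x, 4) (ValF v4, 0)"
      using A unfolding ext.simps(5) Int_iff canon_aup by blast+
    then have "v0 = val s (d - 1)" "v1 = val s d" "v2 = val s (d + 1)" "v3 = val s 0" "v4 = val s (- 1)"
      by (simp_all add: x child_node_def child_off_def s_def)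
    with step[OF t s_def, of d] have "val (nat (t mod 2 ^ m)) d = step v0 v1 v2 v3 v4" by simp
    then show "x \<in> conc \<pi>' (ValF (step v0 v1 v2 v3 v4), 0)" by (cases \<pi>') (simp add: x)
  qed
qed

lemma canon_const:
  assumes "\<not> bad (val (2 ^ m - 1) 0)"
  shows "sat_all canon (inst 0 const_gcis)"
proof -
  have val0: "val 0 d = val 0 (d mod 2 ^ m)" "0 \<le> d mod 2 ^ m" "d mod 2 ^ m < 2 ^ m" for d :: int
    using val_mod[of 0 d] by simp_all
  note simps = canon_aup reg_of_def carry_def flips_def child_node_def child_off_def pred_mod
    dvd_succ_mod_iff
  have "x \<in> ext canon (x, c) (And (Atom (ActF c, 0)) (Ex [] (Atom (SuccF, 0))))" for x c
    by (simp del: split_paired_Ex)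
  then have "sat_gci canon (GCI (Box Star) Top (Modal (Dia Star) (And (Atom (ActF c, 0)) (Ex [] (Atom (SuccF, 0))))))" for c
    unfolding sat_gci.simps ext.simps(7) canon_simps(3) by blast
  moreover have "sat_gci canon (GCI (Box Star) Top (Ex [] (Nominal [])))"
    by auto
  moreover have "sat_gci canon (imp Top (CarryF op True, 0))" for op
    unfolding canon_imp by (auto simp: carry_0)
  moreover have "sat_gci canon (imp (Atom (CarryEndF OffDec True, 0)) (PosF, 0))"
    "sat_gci canon (imp (And (Atom (CarryEndF OffDec False, 0)) (aup 0 (BigF, 0))) (BigF, 0))"
    unfolding canon_imp by (auto simp: simps)
  moreover have "sat_gci canon (imp (And (Atom (CarryEndF TimeDec True, 0)) (Atom (PosF, 0))) (ValF v_start, 0))"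
  proof -
    have "val 0 d = v_start" if "2 ^ m dvd d" for d
      using val0[of d] val_0[of 0] that by simp
    then show ?thesis unfolding canon_imp by (auto simp: simps dvd_eq_mod_eq_0)
  qed
  moreover have "sat_gci canon (imp (And (Atom (CarryEndF TimeDec True, 0))
      (And (Atom (BigF, 0)) (Atom (CarryEndF OffInc False, 0)))) (ValF v_blank, 0))"
  proof -
    have "val 0 d = v_blank" if "int (length w) < d mod 2 ^ m" "d mod 2 ^ m \<noteq> 2 ^ m - 1" for d
      using val0[of d] val_0[of "d mod 2 ^ m"] that by auto
    then show ?thesis unfolding canon_imp by (auto simp: simps)
  qed
  moreover have "sat_gci canon (imp (And (Atom (CarryEndF TimeDec True, 0)) (Atom (CarryEndF OffInc True, 0))) (ValF v_out, 0))"
  proof -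
    \<comment> \<open>Keeps the offset -1, i.e. 2 ^ m - 1, apart from offset 0 and from the input
      positions.\<close>
    have "int (length w) + 2 \<le> 2 ^ m" using size by (metis of_nat_add of_nat_le_iff of_nat_numeral of_nat_power)
    then have "val 0 d = v_out" if "d mod 2 ^ m = 2 ^ m - 1" for d
      using val0[of d] val_0[of "d mod 2 ^ m"] that by auto
    then show ?thesis unfolding canon_imp by (auto simp: simps)
  qed
  moreover have "sat_gci canon (GCI (Box Star) (And (Nominal []) (Atom (ValF v, 0))) Bot)" if "bad v" for v
  proof -
    \<comment> \<open>The root has time -1, which is read as the last time.\<close>
    have "nat (- 1 mod 2 ^ m) = (2 :: nat) ^ m - 1"
      by (simp add: zmod_minus1 nat_diff_distrib nat_power_eq)
    then show ?thesis using assms that by auto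
  qed
  ultimately show ?thesis using canon_step by (simp add: const_gcis_def)
qed

theorem satisfiable_tbox_iff:
  "(\<exists>S :: ('v family \<times> nat, name, name, name, 'd, 'p) sp_struct. standpoint_structure S \<and> sat_all S (tbox w m)) \<Longrightarrow>
     \<not> bad (val (2 ^ m - 1) 0)"
  "\<not> bad (val (2 ^ m - 1) 0) \<Longrightarrow> standpoint_structure canon \<and> sat_all canon (tbox w m)"
  using not_bad canon canon_const canon_bit canon_end canon_big canon_input by (auto simp: tbox_def)

end


section \<open>Counter programs\<close>

instance sym :: countable by countable_datatype

datatype cmd =
    Mv nat bool
  | Emit bool
  | While nat "sym list" "cmd list"
  | If nat "sym list" "cmd list"

instance cmd :: countable by countable_datatype

type_synonym pstate = "(nat \<Rightarrow> nat) \<times> bool list"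

text \<open>Only head 0 sees a word. Every other head sees \<open>Start\<close> at position 0 and
  \<open>Blank\<close> elsewhere, which is the zero test of a counter.\<close>

definition scan :: "bool list \<Rightarrow> (nat \<Rightarrow> nat) \<Rightarrow> nat \<Rightarrow> sym" where
  "scan w h i = (if i = 0 then word_tape w (h 0) else word_tape [] (h i))"

fun cstep :: "bool list \<Rightarrow> cmd list \<times> pstate \<Rightarrow> cmd list \<times> pstate" where
  "cstep w ([], s) = ([], s)"
| "cstep w (Mv i right # c, h, out) = (c, h(i := if right then h i + 1 else h i - 1), out)"
| "cstep w (Emit b # c, h, out) = (c, h, out @ [b])"
| "cstep w (While i X P # c, h, out) =
     (if scan w h i \<in> set X then (P @ While i X P # c, h, out) else (c, h, out))"
| "cstep w (If i X P # c, h, out) = (if scan w h i \<in> set X then (P @ c, h, out) else (c, h, out))"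

text \<open>Quantifying over the remaining commands \<open>c\<close> makes runs composable; the
  number of steps does not depend on \<open>c\<close>, and \<open>t\<close> is only a bound for
  it.\<close>

definition runs :: "bool list \<Rightarrow> cmd list \<Rightarrow> pstate \<Rightarrow> pstate \<Rightarrow> nat \<Rightarrow> bool" where
  "runs w P s s' t \<longleftrightarrow> (\<exists>t'\<le>t. \<forall>c. (cstep w ^^ t') (P @ c, s) = (c, s'))"

lemma runs_mono: "runs w P s s' t \<Longrightarrow> t \<le> u \<Longrightarrow> runs w P s s' u"
  unfolding runs_def by (meson order_trans)

lemma runs_Nil: "runs w [] s s 0"
  by (simp add: runs_def)

lemma runs_append: "runs w P s s' t \<Longrightarrow> runs w Q s' s'' u \<Longrightarrow> runs w (P @ Q) s s'' (t + u)"
  unfolding runs_def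
proof (elim exE conjE)
  fix t' u' assume "t' \<le> t" "u' \<le> u"
    and P: "\<forall>c. (cstep w ^^ t') (P @ c, s) = (c, s')"
    and Q: "\<forall>c. (cstep w ^^ u') (Q @ c, s') = (c, s'')"
  have "(cstep w ^^ (u' + t')) ((P @ Q) @ c, s) = (c, s'')" for c
    using P Q by (simp add: funpow_add)
  then show "\<exists>v\<le>t + u. \<forall>c. (cstep w ^^ v) ((P @ Q) @ c, s) = (c, s'')"
    using \<open>t' \<le> t\<close> \<open>u' \<le> u\<close> by (metis add.commute add_mono)
qed

lemma runs_step:
  assumes "\<And>c. cstep w (a # c, s) = (P @ c, s')" "runs w P s' s'' t"
  shows "runs w [a] s s'' (Suc t)"
proof -
  from assms(2) obtain t' where t': "t' \<le> t" "\<And>c. (cstep w ^^ t') (P @ c, s') = (c, s'')"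
    unfolding runs_def by blast
  have "(cstep w ^^ Suc t') ([a] @ c, s) = (c, s'')" for c
    using assms(1) t'(2) by (simp add: funpow_swap1)
  then show ?thesis unfolding runs_def using t'(1) by (meson Suc_le_mono)
qed

lemma runs_Cons:
  "runs w [a] s s' t \<Longrightarrow> runs w P s' s'' u \<Longrightarrow> runs w (a # P) s s'' (t + u)"
  using runs_append[of w "[a]" s s' t P s'' u] by simp

lemma runs_Mv: "runs w [Mv i r] (h, out) (h(i := if r then h i + 1 else h i - 1), out) 1"
  using runs_step[of w "Mv i r" "(h, out)" "[]", OF _ runs_Nil] by simp

lemma runs_Emit: "runs w [Emit b] (h, out) (h, out @ [b]) 1"
  using runs_step[of w "Emit b" "(h, out)" "[]", OF _ runs_Nil] by simp

lemma runs_If: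
  "(scan w h i \<in> set X \<Longrightarrow> runs w P (h, out) s t) \<Longrightarrow>
   (scan w h i \<notin> set X \<Longrightarrow> s = (h, out)) \<Longrightarrow> runs w [If i X P] (h, out) s (Suc t)"
proof (cases "scan w h i \<in> set X")
  case True
  assume "scan w h i \<in> set X \<Longrightarrow> runs w P (h, out) s t"
  with True show ?thesis by (intro runs_step[of w _ _ P]) simp_all
next
  case False
  assume "scan w h i \<notin> set X \<Longrightarrow> s = (h, out)"
  with False show ?thesis
    using runs_mono[OF runs_Nil] by (intro runs_step[of w _ _ "[]"]) simp_all
qed

lemma runs_While_stop: "scan w h i \<notin> set X \<Longrightarrow> runs w [While i X P] (h, out) (h, out) 1"
  using runs_step[of w "While i X P" "(h, out)" "[]", OF _ runs_Nil] by simp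

lemma runs_While_step:
  assumes "scan w h i \<in> set X" "runs w P (h, out) s t" "runs w [While i X P] s s' u"
  shows "runs w [While i X P] (h, out) s' (Suc (t + u))"
  by (rule runs_step[of w _ _ "P @ [While i X P]"]) (use assms runs_append[OF assms(2,3)] in simp_all)

lemma runs_While:
  fixes h :: "nat \<Rightarrow> nat \<Rightarrow> nat" and out :: "nat \<Rightarrow> bool list"
  assumes "\<And>k. k < N \<Longrightarrow> scan w (h k) i \<in> set X"
    and "\<And>k. k < N \<Longrightarrow> runs w P (h k, out k) (h (Suc k), out (Suc k)) B"
    and "scan w (h N) i \<notin> set X"
  shows "runs w [While i X P] (h 0, out 0) (h N, out N) (Suc (N * Suc B))"
proof -
  \<comment> \<open>Induction on the number \<open>k\<close> of iterations still to be done, since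
    the loop unfolds at its front.\<close>
  have "runs w [While i X P] (h (N - k), out (N - k)) (h N, out N) (Suc (k * Suc B))"
    if "k \<le> N" for k
    using that
  proof (induction k)
    case 0 then show ?case using runs_While_stop[OF assms(3)] by simp
  next
    case (Suc k)
    have S: "Suc (N - Suc k) = N - k" using Suc.prems by simp
    have "runs w [While i X P] (h (N - Suc k), out (N - Suc k)) (h N, out N)
        (Suc (B + Suc (k * Suc B)))"
      using Suc S assms(1)[of "N - Suc k"] assms(2)[of "N - Suc k"]
      by (intro runs_While_step) auto
    then show ?case by (simp add: add_ac)
  qed
  from this[of N] show ?thesis by simp
qed


section \<open>Counter programs run on Turing machines\<close>

text \<open>The control points of a program followed by the commands \<open>c\<close>. These
  finitely many command lists supply the states of the machine.\<close>

fun conts :: "cmd list \<Rightarrow> cmd list \<Rightarrow> cmd list set" and conts1 :: "cmd \<Rightarrow> cmd list \<Rightarrow> cmd list set"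
  where
  "conts [] c = {c}"
| "conts (a # P) c = insert (a # P @ c) (conts1 a (P @ c) \<union> conts P c)"
| "conts1 (Mv i r) c = {}"
| "conts1 (Emit b) c = {}"
| "conts1 (While i X P) c = conts P (While i X P # c)"
| "conts1 (If i X P) c = conts P c"

lemma finite_conts: "finite (conts P c)" "finite (conts1 a c)"
  by (induction P c and a c rule: conts_conts1.induct) auto

lemma conts_refl: "P @ c \<in> conts P c"
  by (cases P) auto

lemma conts_end: "c \<in> conts P c"
  by (induction P) auto

fun succs :: "cmd list \<Rightarrow> cmd list set" where
  "succs [] = {[]}"
| "succs (While i X P # c) = {c, P @ While i X P # c}"
| "succs (If i X P # c) = {c, P @ c}"
| "succs (a # c) = {c}"

lemma conts1_start: "succs (a # c) \<subseteq> insert c (conts1 a c)"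
  using conts_refl by (cases a) auto

text \<open>Closure under the flow of control. The exception is \<open>c\<close> itself, where
  control leaves the program; for the whole program \<open>c = []\<close>, which is its own
  successor.\<close>

lemma conts_succs:
  "P' \<in> conts P c \<Longrightarrow> P' = c \<or> succs P' \<subseteq> conts P c"
  "P' \<in> conts1 a c \<Longrightarrow> P' = c \<or> succs P' \<subseteq> insert c (conts1 a c)"
proof (induction P c and a c rule: conts_conts1.induct)
  case (2 a P c)
  show ?case
  proof (cases "P' = P @ c \<or> P' \<in> conts P c")
    case True
    then show ?thesis using 2(2) conts_refl[of P c] by auto
  next
    case False
    then have "P' = a # P @ c \<or> P' \<in> conts1 a (P @ c)" using 2(3) by simp
    then have "succs P' \<subseteq> insert (P @ c) (conts1 a (P @ c))"
      using 2(1) False conts1_start[of a "P @ c"] by blast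
    then show ?thesis using conts_refl[of P c] by auto
  qed
next
  case (5 i X P c)
  then show ?case using conts1_start[of "While i X P" c] by auto
qed auto

fun tapes_below :: "nat \<Rightarrow> cmd list \<Rightarrow> bool" and tapes_below1 :: "nat \<Rightarrow> cmd \<Rightarrow> bool" where
  "tapes_below K [] = True"
| "tapes_below K (a # P) = (tapes_below1 K a \<and> tapes_below K P)"
| "tapes_below1 K (Mv i r) = (i < K)"
| "tapes_below1 K (Emit b) = True"
| "tapes_below1 K (While i X P) = (i < K \<and> tapes_below K P)"
| "tapes_below1 K (If i X P) = (i < K \<and> tapes_below K P)"

lemma tapes_below_append [simp]:
  "tapes_below K (P @ Q) \<longleftrightarrow> tapes_below K P \<and> tapes_below K Q"
  by (induction P) auto

lemma tapes_below_cstep: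
  "tapes_below K P \<Longrightarrow> tapes_below K (fst (cstep w (P, s)))"
  by (cases "(w, P, s)" rule: cstep.cases) auto

text \<open>The shift by two keeps the states 0 and 1 free.\<close>

definition pc :: "cmd list \<Rightarrow> nat" where
  "pc c = Suc (Suc (to_nat c))"

lemma pc_eq_iff [simp]: "pc c = pc c' \<longleftrightarrow> c = c'" "pc c \<noteq> 0" "pc c \<noteq> Suc 0"
  by (simp_all add: pc_def)

text \<open>State \<open>0\<close> moves the output head off the end marker; state \<open>1\<close> is the rejecting
  state, which is never reached.\<close>

definition prog_delta :: "nat \<Rightarrow> cmd list \<Rightarrow> nat \<Rightarrow> sym list \<Rightarrow> nat \<times> (sym \<times> dir) list" where
  "prog_delta K P q xs =
    (let stay = map (\<lambda>x. (x, Stay)) xs in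
     if q = 0 then (pc P, stay[K := (xs ! K, MoveRight)])
     else if q = 1 then (1, stay)
     else case from_nat (q - 2) of
       [] \<Rightarrow> (q, stay)
     | a # c \<Rightarrow> (case a of
         Mv i r \<Rightarrow> (pc c, stay[i := (xs ! i, if r then MoveRight else MoveLeft)])
       | Emit b \<Rightarrow> (pc c, stay[K := (Bit b, MoveRight)])
       | While i X Q \<Rightarrow> (pc (if xs ! i \<in> set X then Q @ a # c else c), stay)
       | If i X Q \<Rightarrow> (pc (if xs ! i \<in> set X then Q @ c else c), stay)))"

definition prog_tm :: "nat \<Rightarrow> cmd list \<Rightarrow> tm" where
  "prog_tm K P = \<lparr>tapes = Suc K, states = {0, 1} \<union> pc ` conts P [],
     symbols = {Blank, Start, Bit False, Bit True}, init = 0, accept = pc [], reject = 1,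
     delta = prog_delta K P\<rparr>"

lemma prog_tm_simps [simp]:
  "tapes (prog_tm K P) = Suc K" "states (prog_tm K P) = {0, 1} \<union> pc ` conts P []"
  "symbols (prog_tm K P) = {Blank, Start, Bit False, Bit True}" "init (prog_tm K P) = 0"
  "accept (prog_tm K P) = pc []" "reject (prog_tm K P) = 1"
  "delta (prog_tm K P) = prog_delta K P"
  by (simp_all add: prog_tm_def)

lemma prog_delta_pc:
  "prog_delta K P (pc c) xs = (let stay = map (\<lambda>x. (x, Stay)) xs in case c of
       [] \<Rightarrow> (pc [], stay)
     | a # c \<Rightarrow> (case a of
         Mv i r \<Rightarrow> (pc c, stay[i := (xs ! i, if r then MoveRight else MoveLeft)])
       | Emit b \<Rightarrow> (pc c, stay[K := (Bit b, MoveRight)])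
       | While i X Q \<Rightarrow> (pc (if xs ! i \<in> set X then Q @ a # c else c), stay)
       | If i X Q \<Rightarrow> (pc (if xs ! i \<in> set X then Q @ c else c), stay)))"
  by (auto simp: prog_delta_def pc_def Let_def split: list.split cmd.split)

lemma prog_delta_succs: "fst (prog_delta K P (pc c) xs) \<in> pc ` succs c"
  by (auto simp: prog_delta_pc Let_def split: list.split cmd.split)

lemma prog_delta_actions:
  assumes "length xs = Suc K" "set xs \<subseteq> B" "\<And>b. Bit b \<in> B" "prog_delta K P q xs = (q', as)"
  shows "length as = Suc K \<and> fst ` set as \<subseteq> B"
proof -
  define ok where "ok = (\<lambda>as :: (sym \<times> dir) list. length as = Suc K \<and> fst ` set as \<subseteq> B)"
  define stay where "stay = map (\<lambda>x. (x, Stay)) xs"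
  have stay: "ok stay" using assms(1,2) by (auto simp: stay_def ok_def)
  have upd: "ok (stay[i := (y, d)])" if "y \<in> B" for i y d
    using stay that set_update_subset_insert[of stay i "(y, d)"] unfolding ok_def by fastforce
  have same: "ok (stay[i := (xs ! i, d)])" for i d
  proof (cases "i < length xs")
    case True
    then have "xs ! i \<in> B" using assms(2) nth_mem by blast
    then show ?thesis by (rule upd)
  next
    case False
    then have "stay[i := (xs ! i, d)] = stay" by (intro list_update_beyond) (simp add: stay_def)
    then show ?thesis using stay by simp
  qed
  have "ok (snd (prog_delta K P q xs))"
    unfolding prog_delta_def stay_def[symmetric] Let_def
    using stay upd[OF assms(3)] same by (simp split: list.split cmd.split)
  then show ?thesis using assms(4) by (simp add: ok_def)
qed

lemma turing_machine_prog_tm: "turing_machine (prog_tm K P)"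
proof -
  define B where "B = {Blank, Start, Bit False, Bit True}"
  have B: "Bit b \<in> B" for b by (cases b) (simp_all add: B_def)
  have "q' \<in> {0, 1} \<union> pc ` conts P []"
    if q: "q \<in> {0, 1} \<union> pc ` conts P []" and d: "prog_delta K P q xs = (q', as)" for q xs q' as
  proof (cases "q \<in> {0, 1}")
    case True
    then show ?thesis using d conts_refl[of P "[]"] by (auto simp: prog_delta_def Let_def)
  next
    case False
    then obtain c where c: "q = pc c" "c \<in> conts P []" using q by auto
    have "succs c \<subseteq> conts P []" using conts_succs(1)[OF c(2)] c(2) by auto
    then show ?thesis using prog_delta_succs[of K P c xs] d c by auto
  qed
  then show ?thesis
    using finite_conts(1)[of P "[]"] conts_end[of "[]" P] prog_delta_actions[of _ K B P] B
    unfolding turing_machine_def prog_tm_simps B_def[symmetric] by (auto simp: B_def)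
qed

text \<open>The output head stands on the first blank after the output; as cell 0 holds the end
  marker, this is cell \<open>Suc (length out)\<close>.\<close>

definition prog_conf :: "nat \<Rightarrow> bool list \<Rightarrow> cmd list \<times> pstate \<Rightarrow> config" where
  "prog_conf K w = (\<lambda>(c, h, out). (pc c, map (\<lambda>i. if i < K
     then (word_tape (if i = 0 then w else []), h i) else (word_tape out, Suc (length out)))
     [0..<Suc K]))"

lemma act_Stay: "act (read_tape t, Stay) t = t"
  by (cases t) (simp add: act_def read_tape_def)

lemma word_tape_snoc: "(word_tape out)(Suc (length out) := Bit b) = word_tape (out @ [b])"
  by (rule ext) (auto simp: word_tape_def nth_append)

lemma tm_step_prog_conf:
  assumes "tapes_below K P'" "P' \<noteq> []"
  shows "tm_step (prog_tm K P) (prog_conf K w (P', s)) = prog_conf K w (cstep w (P', s))"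
proof -
  obtain h out where s: "s = (h, out)" by fastforce
  define ts where "ts = snd (prog_conf K w (P', s))"
  have len: "length ts = Suc K" by (simp add: ts_def s prog_conf_def)
  have nth: "ts ! i = (if i < K then (word_tape (if i = 0 then w else []), h i)
      else (word_tape out, Suc (length out)))" if "i \<le> K" for i
    using that by (simp add: ts_def s prog_conf_def del: upt_Suc)
  have scan: "scan w h i = read_tape (ts ! i)" if "i < K" for i
    using that by (simp add: nth scan_def read_tape_def)
  obtain a c where P': "P' = a # c" using assms(2) by (cases P') auto
  have stay: "map2 act (map (\<lambda>x. (x, Stay)) (map read_tape ts)) ts = ts"
    by (rule nth_equalityI) (simp_all add: act_Stay)
  have upd: "map2 act ((map (\<lambda>x. (x, Stay)) (map read_tape ts))[i := x]) ts = ts[i := act x (ts ! i)]"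
    if "i \<le> K" for i x
    using that len by (intro nth_equalityI) (auto simp: act_Stay nth_list_update)
  have conf: "prog_conf K w (P', s) = (pc P', ts)"
    by (simp add: ts_def s prog_conf_def)
  have conf': "prog_conf K w (c', h', out') = (pc c', ts')"
    if "length ts' = Suc K" "\<And>i. i \<le> K \<Longrightarrow> ts' ! i = (if i < K then
      (word_tape (if i = 0 then w else []), h' i) else (word_tape out', Suc (length out')))"
    for c' h' out' ts'
    unfolding prog_conf_def using that
    by (auto simp del: upt_Suc intro!: nth_equalityI)
  have not_halted: "\<not> halted (prog_tm K P) (prog_conf K w (P', s))"
    unfolding conf halted_def using assms by simp
  have same: "(pc c', ts) = prog_conf K w (c', h, out)" for c'
    by (rule conf'[symmetric]) (use len nth in auto)
  show ?thesis
  proof (cases a)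
    case (Mv i r)
    then show ?thesis using not_halted assms unfolding tm_step_def conf
      by (auto simp: prog_delta_pc P' Let_def upd s act_def read_tape_def nth_list_update len nth
          map_nth scan intro!: conf'[symmetric])
  next
    case (Emit b)
    then show ?thesis using not_halted assms unfolding tm_step_def conf
      by (auto simp: prog_delta_pc P' Let_def upd s act_def nth_list_update len nth read_tape_def word_tape_snoc
          intro!: conf'[symmetric])
  next
    case (While i X Q)
    then show ?thesis using not_halted assms unfolding tm_step_def conf
      by (auto simp: prog_delta_pc P' Let_def stay[simplified] s scan same[symmetric] len)
  next
    case (If i X Q)
    then show ?thesis using not_halted assms unfolding tm_step_def conf
      by (auto simp: prog_delta_pc P' Let_def stay[simplified] s scan same[symmetric] len)
  qed
qed


lemma halted_run:
  assumes "halted M (tm_run M w t)" "t \<le> u"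
  shows "tm_run M w u = tm_run M w t"
proof -
  have "tm_run M w (t + k) = tm_run M w t" for k
    by (induction k) (use assms(1) in \<open>auto simp: tm_run_def tm_step_def\<close>)
  then show ?thesis using assms(2) by (metis le_Suc_ex)
qed

theorem polytime_computable_prog:
  fixes p :: "nat poly"
  assumes "tapes_below K P" "K \<ge> 1"
    and "\<And>w. \<exists>h t. runs w P (\<lambda>_. 0, []) (h, f w) t \<and> t \<le> poly p (length w)"
  shows "polytime_computable f"
proof -
  let ?M = "prog_tm K P"
  \<comment> \<open>The extra step is the initial one, which moves the output head off the end
    marker.\<close>
  have "\<exists>t\<le>poly (p + 1) (length w). \<exists>h. tm_run ?M w t = prog_conf K w ([], h, f w)" for w
  proof -
    have "tm_run ?M w 1 = prog_conf K w (P, \<lambda>_. 0, [])"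
      using assms(2)
      by (cases K) (auto simp: tm_run_def start_config_def tm_step_def halted_def prog_delta_def
          Let_def prog_conf_def act_def read_tape_def simp del: upt_Suc replicate.simps
          intro!: nth_equalityI simp: nth_list_update nth_append)
    moreover have "tm_run ?M w (Suc j) = prog_conf K w ((cstep w ^^ j) (P, \<lambda>_. 0, [])) \<and>
        tapes_below K (fst ((cstep w ^^ j) (P, \<lambda>_. 0, [])))"
      if "\<And>i. i < j \<Longrightarrow> fst ((cstep w ^^ i) (P, \<lambda>_. 0, [])) \<noteq> []" for j
      using that
    proof (induction j)
      case 0
      then show ?case using calculation assms(1) by simp
    next
      case (Suc j)
      obtain c s where cs: "(cstep w ^^ j) (P, \<lambda>_. 0, []) = (c, s)" using prod.exhaust by blast
      have "tm_run ?M w (Suc (Suc j)) = tm_step ?M (tm_run ?M w (Suc j))"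
        by (simp add: tm_run_def)
      moreover have "tm_run ?M w (Suc j) = prog_conf K w (c, s) \<and> tapes_below K c"
        using Suc.IH[unfolded cs] Suc.prems less_SucI by (metis fst_conv)
      moreover have "c \<noteq> []"
        using Suc.prems[of j] cs by (metis fst_conv lessI)
      ultimately show ?case using tm_step_prog_conf[of K c P w s] tapes_below_cstep[of K c w s]
        by (simp add: cs)
    qed
    moreover obtain h t where t: "t \<le> poly p (length w)"
      "(cstep w ^^ t) (P, \<lambda>_. 0, []) = ([], h, f w)"
    proof -
      from assms(3)[of w] obtain h t t' where "t' \<le> t" "t \<le> poly p (length w)"
        "\<And>c. (cstep w ^^ t') (P @ c, \<lambda>_. 0, []) = (c, h, f w)"
        unfolding runs_def by blast
      from this(1,2) this(3)[of "[]"] show ?thesis by (intro that[of t' h]) auto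
    qed
    \<comment> \<open>The first time at which no command is left: machine and program proceed in
      step only while commands remain, and after that the program state no longer changes.\<close>
    define k where "k = (LEAST j. fst ((cstep w ^^ j) (P, \<lambda>_. 0, [])) = [])"
    have "fst ((cstep w ^^ t) (P, \<lambda>_. 0, [])) = []" by (simp add: t(2))
    then have k: "fst ((cstep w ^^ k) (P, \<lambda>_. 0, [])) = []" "k \<le> t"
      "\<And>i. i < k \<Longrightarrow> fst ((cstep w ^^ i) (P, \<lambda>_. 0, [])) \<noteq> []"
      unfolding k_def
      by - (erule LeastI, erule Least_le, drule not_less_Least, assumption)
    have "(cstep w ^^ (i + k)) (P, \<lambda>_. 0, []) = (cstep w ^^ k) (P, \<lambda>_. 0, [])" for i
    proof (induction i)
      case (Suc i)
      then show ?case using k(1) by (cases "(cstep w ^^ k) (P, \<lambda>_. 0, [])") auto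
    qed simp
    from this[of "t - k"] have "(cstep w ^^ k) (P, \<lambda>_. 0, []) = ([], h, f w)"
      using k(2) t(2) by simp
    ultimately show ?thesis using k t(1) by (intro exI[of _ "Suc k"]) auto
  qed
  then have "computes_in_time ?M f (\<lambda>n. poly (p + 1) n)"
    unfolding computes_in_time_def
  proof (intro allI)
    fix w
    assume "\<And>w. \<exists>t\<le>poly (p + 1) (length w). \<exists>h. tm_run ?M w t = prog_conf K w ([], h, f w)"
    then obtain t h where t: "t \<le> poly (p + 1) (length w)" "tm_run ?M w t = prog_conf K w ([], h, f w)"
      by blast
    have "halted ?M (tm_run ?M w t)" by (simp add: t halted_def prog_conf_def)
    from halted_run[OF this t(1)] this
    show "let c = tm_run ?M w (poly (p + 1) (length w))
          in halted ?M c \<and> fst (last (snd c)) = word_tape (f w)"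
      by (simp add: t(2) prog_conf_def)
  qed
  then show ?thesis unfolding polytime_computable_def using turing_machine_prog_tm by blast
qed


section \<open>Emitting templates with a unary index\<close>

definition polyb :: "(nat \<Rightarrow> nat) \<Rightarrow> bool" where
  "polyb f \<longleftrightarrow> (\<exists>P :: nat poly. \<forall>n. f n \<le> poly P n)"

lemma polyb_poly: "polyb (poly p)"
  unfolding polyb_def by blast

lemma polyb_const: "polyb (\<lambda>_. c)"
  unfolding polyb_def by (rule exI[of _ "[:c:]"]) simp

lemma polyb_id: "polyb (\<lambda>n. n)"
  unfolding polyb_def by (rule exI[of _ "[:0, 1:]"]) simp

lemma polyb_add: "polyb f \<Longrightarrow> polyb g \<Longrightarrow> polyb (\<lambda>n. f n + g n)"
  unfolding polyb_def by (metis add_mono poly_add)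

lemma polyb_mult: "polyb f \<Longrightarrow> polyb g \<Longrightarrow> polyb (\<lambda>n. f n * g n)"
  unfolding polyb_def by (metis mult_le_mono poly_mult)

lemma polyb_Suc: "polyb f \<Longrightarrow> polyb (\<lambda>n. Suc (f n))"
  using polyb_add[of f "\<lambda>_. 1"] polyb_const by simp

lemmas polyb_intros = polyb_poly polyb_const polyb_id polyb_add polyb_mult polyb_Suc

text \<open>The default 0 beyond the list lets the all-zero initial positions be written as a list
  of zeros.\<close>

definition heads :: "nat list \<Rightarrow> nat \<Rightarrow> nat" where
  "heads xs k = (if k < length xs then xs ! k else 0)"

lemma runs_Mv_right:
  "i < length xs \<Longrightarrow>
   runs w [Mv i True] (heads xs, out) (heads (xs[i := Suc (xs ! i)]), out) 1"
proof -
  assume "i < length xs"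
  then have "(heads xs)(i := heads xs i + 1) = heads (xs[i := Suc (xs ! i)])"
    by (auto simp: heads_def)
  then show ?thesis using runs_Mv[of w i True "heads xs" out] by simp
qed

lemma runs_Mv_left:
  "i < length xs \<Longrightarrow>
   runs w [Mv i False] (heads xs, out) (heads (xs[i := xs ! i - 1]), out) 1"
proof -
  assume "i < length xs"
  then have "(heads xs)(i := heads xs i - 1) = heads (xs[i := xs ! i - 1])"
    by (auto simp: heads_def)
  then show ?thesis using runs_Mv[of w i False "heads xs" out] by simp
qed

lemma scan_counter:
  "0 < i \<Longrightarrow> i < length xs \<Longrightarrow> scan w (heads xs) i = (if xs ! i = 0 then Start else Blank)"
  by (simp add: scan_def heads_def word_tape_def)

definition drain :: "nat \<Rightarrow> cmd list \<Rightarrow> cmd list" where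
  "drain i P = [While i [Blank] (Mv i False # P)]"

lemma runs_drain:
  fixes xs :: "nat \<Rightarrow> nat list"
  assumes "0 < i" "\<And>k. i < length (xs k)" "\<And>k. xs k ! i = N - k"
    and "\<And>k. k < N \<Longrightarrow> runs w P (heads ((xs k)[i := N - Suc k]), out k) (heads (xs (Suc k)), out (Suc k)) B"
  shows "runs w (drain i P) (heads (xs 0), out 0) (heads (xs N), out N) (Suc (N * (B + 2)))"
proof -
  have "runs w (Mv i False # P) (heads (xs k), out k) (heads (xs (Suc k)), out (Suc k)) (Suc B)"
    if "k < N" for k
    using runs_Cons[OF runs_Mv_left[OF assms(2)[of k]]] assms(3)[of k] assms(4)[OF that] by simp
  then show ?thesis unfolding drain_def
    using runs_While[of N w "\<lambda>k. heads (xs k)" i "[Blank]" "Mv i False # P" out "Suc B"] assms(1-3)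
    by (simp add: scan_counter)
qed

text \<open>All programs below use six heads: \<open>0\<close> on the input, \<open>1\<close> and \<open>5\<close> as
  indices, \<open>2\<close> as scratch counter that is zero between commands, \<open>3\<close> and \<open>4\<close> for
  evaluating a polynomial.\<close>

definition emit_unary :: "nat \<Rightarrow> cmd list" where
  "emit_unary i = drain i [Mv 2 True, Emit True, Emit True] @ drain 2 [Mv i True]"

lemma runs_emit_unary:
  assumes "length xs = 6" "xs ! 2 = 0" "i < 6" "i \<noteq> 2" "0 < i"
  shows "runs w (emit_unary i) (heads xs, out) (heads xs, out @ replicate (2 * xs ! i) True)
           (8 * (xs ! i + 1))"
proof -
  let ?N = "xs ! i"
  let ?xs = "\<lambda>k. xs[2 := k, i := ?N - k]" and ?out = "\<lambda>k. out @ replicate (2 * k) True"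
  have 1: "runs w (drain i [Mv 2 True, Emit True, Emit True])
      (heads (?xs 0), ?out 0) (heads (?xs ?N), ?out ?N) (Suc (?N * (3 + 2)))"
  proof (rule runs_drain)
    fix k assume "k < ?N"
    show "runs w [Mv 2 True, Emit True, Emit True] (heads ((?xs k)[i := ?N - Suc k]), ?out k)
        (heads (?xs (Suc k)), ?out (Suc k)) 3"
      using runs_mono[OF runs_Cons[OF runs_Mv_right[of 2 "(?xs k)[i := ?N - Suc k]" w "?out k"]
          runs_Cons[OF runs_Emit[of w True] runs_Emit[of w True]]], of 3] assms
      by (simp add: list_update_swap replicate_app_Cons_same)
  qed (use assms in auto)
  let ?ys = "\<lambda>k. xs[i := k, 2 := ?N - k]"
  have 2: "runs w (drain 2 [Mv i True])
      (heads (?ys 0), ?out ?N) (heads (?ys ?N), ?out ?N) (Suc (?N * (1 + 2)))"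
  proof (rule runs_drain)
    fix k assume "k < ?N"
    show "runs w [Mv i True] (heads ((?ys k)[2 := ?N - Suc k]), ?out ?N)
        (heads (?ys (Suc k)), ?out ?N) 1"
      using runs_Mv_right[of i "(?ys k)[2 := ?N - Suc k]" w "?out ?N"] assms
      by (simp add: list_update_swap)
  qed (use assms in auto)
  have "?xs 0 = xs" "?ys 0 = ?xs ?N" "?ys ?N = xs"
    using assms list_update_id[of xs 2] list_update_swap[of i 2 xs] by auto
  then show ?thesis unfolding emit_unary_def
    using runs_mono[OF runs_append[OF 1 2[unfolded \<open>?ys 0 = ?xs ?N\<close>]], of "8 * (xs ! i + 1)"] by simp
qed

type_synonym pieces = "bool option list"

text \<open>A gap \<open>None\<close> is filled with the index in unary, two bits per unit as in \<open>enc_name\<close>.\<close>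

definition fill :: "nat \<Rightarrow> pieces \<Rightarrow> bool list" where
  "fill j ps = concat (map (\<lambda>p. case p of Some b \<Rightarrow> [b] | None \<Rightarrow> replicate (2 * j) True) ps)"

definition emit :: "nat \<Rightarrow> pieces \<Rightarrow> cmd list" where
  "emit i ps = concat (map (\<lambda>p. case p of Some b \<Rightarrow> [Emit b] | None \<Rightarrow> emit_unary i) ps)"

lemma runs_emit:
  assumes "length xs = 6" "xs ! 2 = 0" "i < 6" "i \<noteq> 2" "0 < i"
  shows "runs w (emit i ps) (heads xs, out) (heads xs, out @ fill (xs ! i) ps)
           (length ps * (8 * (xs ! i + 1)))"
proof (induction ps arbitrary: out)
  case Nil then show ?case using runs_Nil by (simp add: emit_def fill_def)
next
  case (Cons p ps)
  show ?case
  proof (cases p)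
    case None
    then show ?thesis
      using runs_append[OF runs_emit_unary[OF assms] Cons.IH] by (simp add: emit_def fill_def)
  next
    case (Some b)
    then show ?thesis
      using runs_mono[OF runs_Cons[OF runs_Emit Cons.IH]] by (simp add: emit_def fill_def)
  qed
qed

subsection \<open>Horner's scheme\<close>

text \<open>Multiplies counter 3 by counter 1. Each unit of counter 3 adds counter 1 to counter 4,
  with counter 2 restoring counter 1; finally counter 4 is moved back to counter 3.\<close>

definition times_n :: "cmd list" where
  "times_n = drain 3 (drain 1 [Mv 2 True, Mv 4 True] @ drain 2 [Mv 1 True]) @ drain 4 [Mv 3 True]"

lemma runs_times_n:
  "runs w times_n (heads [a, n, 0, x, 0, b], out) (heads [a, n, 0, n * x, 0, b], out)
     (x * (7 * n + 4) + 3 * n * x + 2)"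
proof -
  have 1: "runs w (drain 1 [Mv 2 True, Mv 4 True])
      (heads [a, n - 0, 0, y, z + 0, b], out) (heads [a, n - n, n, y, z + n, b], out)
      (Suc (n * (2 + 2)))" for y z
  proof (rule runs_drain[where xs = "\<lambda>k. [a, n - k, k, y, z + k, b]" and out = "\<lambda>_. out"])
    fix k assume "k < n"
    show "runs w [Mv 2 True, Mv 4 True] (heads ([a, n - k, k, y, z + k, b][1 := n - Suc k]), out)
        (heads [a, n - Suc k, Suc k, y, z + Suc k, b], out) 2"
      using runs_mono[OF runs_Cons[OF runs_Mv_right[of 2 "[a, n - Suc k, k, y, z + k, b]", simplified]
          runs_Mv_right[of 4 "[a, n - Suc k, Suc k, y, z + k, b]", simplified]], of 2] by simp
  qed auto
  have 2: "runs w (drain 2 [Mv 1 True])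
      (heads [a, 0, n - 0, y, z, b], out) (heads [a, n, n - n, y, z, b], out)
      (Suc (n * (1 + 2)))" for y z
  proof (rule runs_drain[where xs = "\<lambda>k. [a, k, n - k, y, z, b]" and out = "\<lambda>_. out"])
    fix k
    show "runs w [Mv 1 True] (heads ([a, k, n - k, y, z, b][2 := n - Suc k]), out)
        (heads [a, Suc k, n - Suc k, y, z, b], out) 1"
      using runs_Mv_right[of 1 "[a, k, n - Suc k, y, z, b]" w out] by simp
  qed auto
  have 3: "runs w (drain 1 [Mv 2 True, Mv 4 True] @ drain 2 [Mv 1 True])
      (heads [a, n, 0, y, z, b], out) (heads [a, n, 0, y, z + n, b], out) (7 * n + 2)" for y z
    using runs_append[OF 1[of y z, simplified] 2[of y "z + n", simplified]] by (simp add: algebra_simps)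
  have 4: "runs w (drain 3 (drain 1 [Mv 2 True, Mv 4 True] @ drain 2 [Mv 1 True]))
      (heads [a, n, 0, x - 0, n * 0, b], out) (heads [a, n, 0, x - x, n * x, b], out)
      (Suc (x * ((7 * n + 2) + 2)))"
  proof (rule runs_drain[where xs = "\<lambda>k. [a, n, 0, x - k, n * k, b]" and out = "\<lambda>_. out"])
    fix k
    show "runs w (drain 1 [Mv 2 True, Mv 4 True] @ drain 2 [Mv 1 True])
        (heads ([a, n, 0, x - k, n * k, b][3 := x - Suc k]), out)
        (heads [a, n, 0, x - Suc k, n * Suc k, b], out) (7 * n + 2)"
      using 3[of "x - Suc k" "n * k"] by (simp add: add.commute)
  qed auto
  have 5: "runs w (drain 4 [Mv 3 True])
      (heads [a, n, 0, 0, n * x - 0, b], out) (heads [a, n, 0, n * x, n * x - n * x, b], out)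
      (Suc (n * x * (1 + 2)))"
  proof (rule runs_drain[where xs = "\<lambda>k. [a, n, 0, k, n * x - k, b]" and out = "\<lambda>_. out"])
    fix k
    show "runs w [Mv 3 True] (heads ([a, n, 0, k, n * x - k, b][4 := n * x - Suc k]), out)
        (heads [a, n, 0, Suc k, n * x - Suc k, b], out) 1"
      using runs_Mv_right[of 3 "[a, n, 0, k, n * x - Suc k, b]" w out] by simp
  qed auto
  show ?thesis unfolding times_n_def
    using runs_append[OF 4[simplified] 5[simplified]] by (simp add: algebra_simps)
qed

fun horner :: "nat list \<Rightarrow> cmd list" where
  "horner [] = []"
| "horner (c # cs) = horner cs @ times_n @ replicate c (Mv 3 True)"

lemma runs_replicate:
  "runs w (replicate c (Mv 3 True)) (heads [a, n, 0, x, 0, b], out) (heads [a, n, 0, x + c, 0, b], out) c"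
proof (induction c arbitrary: x)
  case 0 then show ?case using runs_Nil by simp
next
  case (Suc c)
  show ?case using runs_Cons[OF runs_Mv_right[of 3 "[a, n, 0, x, 0, b]", simplified] Suc[of "Suc x", simplified]] by simp
qed

lemma runs_horner:
  "\<exists>T. polyb T \<and> (\<forall>w a n b out. runs w (horner cs) (heads [a, n, 0, 0, 0, b], out)
     (heads [a, n, 0, poly (Poly cs) n, 0, b], out) (T n))"
proof (induction cs)
  case Nil then show ?case using runs_Nil polyb_const[of 0] by auto
next
  case (Cons c cs)
  then obtain T where T: "polyb T" "\<And>w a n b out. runs w (horner cs) (heads [a, n, 0, 0, 0, b], out)
     (heads [a, n, 0, poly (Poly cs) n, 0, b], out) (T n)" by blast
  let ?q = "poly (Poly cs)"
  let ?T = "\<lambda>n. T n + ((?q n * (7 * n + 4) + 3 * n * ?q n + 2) + c)"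
  have "polyb ?T" by (intro polyb_intros T)
  moreover have "runs w (horner (c # cs)) (heads [a, n, 0, 0, 0, b], out)
     (heads [a, n, 0, poly (Poly (c # cs)) n, 0, b], out) (?T n)" for w a n b out
    using runs_append[OF T(2) runs_append[OF runs_times_n runs_replicate]]
    by (simp add: add.commute)
  ultimately show ?case by blast
qed

text \<open>Counter 1 advances together with the input head and therefore ends at the input length,
  ready both for \<open>E\<close> and as argument of the polynomial. The two tests in the loop leave
  head 0 in place, so exactly one of them prints.\<close>

definition template_prog ::
    "nat poly \<Rightarrow> pieces \<Rightarrow> (bool \<Rightarrow> pieces) \<Rightarrow> pieces \<Rightarrow> pieces \<Rightarrow> pieces \<Rightarrow> cmd list" where
  "template_prog p A I E L Z = emit 1 A @ [Mv 0 True] @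
     [While 0 [Bit False, Bit True]
        ([If 0 [Bit False] (emit 1 (I False)), If 0 [Bit True] (emit 1 (I True))] @
         [Mv 0 True, Mv 1 True])] @
     emit 1 E @ horner (coeffs p) @ drain 3 (emit 5 L @ [Mv 5 True]) @ emit 5 Z"

lemma tapes_below_template_prog: "tapes_below 6 (template_prog p A I E L Z)"
proof -
  have u: "tapes_below 6 (emit_unary i)" if "i < 6" for i
    using that by (simp add: emit_unary_def drain_def)
  have e: "tapes_below 6 (emit i ps)" if "i < 6" for i ps
    by (induction ps) (use that u in \<open>auto simp: emit_def split: option.split\<close>)
  have r: "tapes_below 6 (replicate c (Mv 3 True))" for c
    by (induction c) auto
  have "tapes_below 6 (horner cs)" for cs
    by (induction cs) (use r in \<open>auto simp: times_n_def drain_def\<close>)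
  then show ?thesis using e by (simp add: template_prog_def drain_def)
qed

theorem polytime_computable_template:
  fixes p :: "nat poly"
  shows "polytime_computable (\<lambda>w. let n = length w; m = poly p n in
     fill 0 A @ concat (map (\<lambda>j. fill j (I (w ! j))) [0..<n]) @ fill n E @
     concat (map (\<lambda>j. fill j L) [0..<m]) @ fill m Z)"
proof -
  \<comment> \<open>One constant for all templates, from the bound of eight steps per piece and unit
    of the index in \<open>runs_emit\<close>.\<close>
  define l where "l = 8 * (length A + length (I False) + length (I True) + length E + length L + length Z)"
  obtain T where T: "polyb T" "\<And>w a n b out. runs w (horner (coeffs p)) (heads [a, n, 0, 0, 0, b], out)
     (heads [a, n, 0, poly p n, 0, b], out) (T n)"
    using runs_horner[of "coeffs p"] by auto
  let ?B = "\<lambda>n. l * (n + 1)"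
  let ?m = "poly p"
  let ?U = "\<lambda>n. ?B n + (1 + (Suc (n * Suc (Suc (?B n) + (Suc (?B n) + 2))) +
      (?B n + (T n + (Suc (?m n * (?B (?m n) + 1 + 2)) + ?B (?m n))))))"
  have "polyb ?U" by (intro polyb_intros T)
  then obtain q where q: "\<And>n. ?U n \<le> poly q n" unfolding polyb_def by blast
  have len: "length ps * (8 * (j + 1)) \<le> ?B k"
    if "ps \<in> {A, I False, I True, E, L, Z}" "j \<le> k" for ps j k
  proof -
    have "length ps * 8 \<le> l" using that(1) by (auto simp: l_def)
    from mult_le_mono[OF this, of "j + 1" "k + 1"] show ?thesis using that(2) by (simp only: mult.assoc)
  qed
  have emit1: "runs w (emit 1 ps) (heads [a, j, 0, 0, 0, 0], out)
      (heads [a, j, 0, 0, 0, 0], out @ fill j ps) (?B k)"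
    if "ps \<in> {A, I False, I True, E, L, Z}" "j \<le> k" for ps w a j k out
    using runs_mono[OF runs_emit[of "[a, j, 0, 0, 0, 0]" 1 w ps out]] len[OF that] by simp
  have emit5: "runs w (emit 5 ps) (heads [a, n, 0, x, 0, j], out)
      (heads [a, n, 0, x, 0, j], out @ fill j ps) (?B k)"
    if "ps \<in> {A, I False, I True, E, L, Z}" "j \<le> k" for ps w a j k n x out
    using runs_mono[OF runs_emit[of "[a, n, 0, x, 0, j]" 5 w ps out]] len[OF that] by simp
  have "runs w (template_prog p A I E L Z) (\<lambda>_. 0, [])
      (heads [Suc (length w), length w, 0, 0, 0, ?m (length w)],
       (((([] @ fill 0 A) @ concat (map (\<lambda>j. fill j (I (w ! j))) [0..<length w])) @ fill (length w) E) @
       concat (map (\<lambda>j. fill j L) [0..<?m (length w)])) @ fill (?m (length w)) Z) (?U (length w))"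
for w
  proof -
    let ?n = "length w"
    let ?in = "concat (map (\<lambda>j. fill j (I (w ! j))) [0..<?n])"
    let ?loop = "concat (map (\<lambda>j. fill j L) [0..<?m ?n])"
    have h0: "(\<lambda>_. 0) = heads [0, 0, 0, 0, 0, 0]"
      by (auto simp: heads_def fun_eq_iff nth_Cons split: nat.split)
    have sc: "scan w (heads (Suc k # xs)) 0 = (if k < ?n then Bit (w ! k) else Blank)" for k xs
      by (simp add: scan_def heads_def word_tape_def)
    let ?If = "\<lambda>b. If 0 [Bit b] (emit 1 (I b))"
    let ?body = "[?If False, ?If True] @ [Mv 0 True, Mv 1 True]"
    have input: "runs w [While 0 [Bit False, Bit True] ?body]
       (heads [Suc 0, 0, 0, 0, 0, 0], out @ concat (map (\<lambda>j. fill j (I (w ! j))) [0..<0]))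
       (heads [Suc ?n, ?n, 0, 0, 0, 0], out @ ?in)
       (Suc (?n * Suc (Suc (?B ?n) + (Suc (?B ?n) + 2))))" for out
    proof (rule runs_While[where h = "\<lambda>k. heads [Suc k, k, 0, 0, 0, 0]" and
          out = "\<lambda>k. out @ concat (map (\<lambda>j. fill j (I (w ! j))) [0..<k])"])
      fix k assume k: "k < ?n"
      show "scan w (heads [Suc k, k, 0, 0, 0, 0]) 0 \<in> set [Bit False, Bit True]"
        using k by (auto simp: sc)
      have If: "runs w [?If b] (heads [Suc k, k, 0, 0, 0, 0], out')
         (heads [Suc k, k, 0, 0, 0, 0], out' @ (if w ! k = b then fill k (I b) else [])) (Suc (?B ?n))"
        for b out'
        using emit1[of "I b" k ?n w "Suc k" out'] k by (intro runs_If) (auto simp: sc)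
      have Mvs: "runs w [Mv 0 True, Mv 1 True] (heads [Suc k, k, 0, 0, 0, 0], out')
         (heads [Suc (Suc k), Suc k, 0, 0, 0, 0], out') 2" for out'
        using runs_Cons[OF runs_Mv_right[of 0 "[Suc k, k, 0, 0, 0, 0]" w out', simplified]
            runs_Mv_right[of 1 "[Suc (Suc k), k, 0, 0, 0, 0]" w out', simplified], simplified]
        by (simp add: numeral_2_eq_2)
      have "(if w ! k = False then fill k (I False) else []) @ (if w ! k = True then fill k (I True) else []) =
          fill k (I (w ! k))" by auto
      then show "runs w ?body
        (heads [Suc k, k, 0, 0, 0, 0], out @ concat (map (\<lambda>j. fill j (I (w ! j))) [0..<k]))
        (heads [Suc (Suc k), Suc k, 0, 0, 0, 0], out @ concat (map (\<lambda>j. fill j (I (w ! j))) [0..<Suc k]))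
        (Suc (?B ?n) + (Suc (?B ?n) + 2))"
        using runs_Cons[OF If[of False "out @ concat (map (\<lambda>j. fill j (I (w ! j))) [0..<k])"]
            runs_Cons[OF If[of True] Mvs]] by simp
    next
      show "scan w (heads [Suc ?n, ?n, 0, 0, 0, 0]) 0 \<notin> set [Bit False, Bit True]"
        by (simp add: sc)
    qed
    have loop: "runs w (drain 3 (emit 5 L @ [Mv 5 True]))
      (heads [Suc ?n, ?n, 0, ?m ?n - 0, 0, 0], out @ concat (map (\<lambda>j. fill j L) [0..<0]))
      (heads [Suc ?n, ?n, 0, ?m ?n - ?m ?n, 0, ?m ?n], out @ ?loop)
      (Suc (?m ?n * (?B (?m ?n) + 1 + 2)))" for out
    proof (rule runs_drain[where xs = "\<lambda>k. [Suc ?n, ?n, 0, ?m ?n - k, 0, k]" and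
          out = "\<lambda>k. out @ concat (map (\<lambda>j. fill j L) [0..<k])"])
      fix k assume "k < ?m ?n"
      then show "runs w (emit 5 L @ [Mv 5 True])
        (heads ([Suc ?n, ?n, 0, ?m ?n - k, 0, k][3 := ?m ?n - Suc k]), out @ concat (map (\<lambda>j. fill j L) [0..<k]))
        (heads [Suc ?n, ?n, 0, ?m ?n - Suc k, 0, Suc k], out @ concat (map (\<lambda>j. fill j L) [0..<Suc k]))
        (?B (?m ?n) + 1)"
        using runs_append[OF emit5[of L k "?m ?n" w "Suc ?n" ?n "?m ?n - Suc k"
              "out @ concat (map (\<lambda>j. fill j L) [0..<k])"]
            runs_Mv_right[of 5 "[Suc ?n, ?n, 0, ?m ?n - Suc k, 0, k]", simplified]]
        by simp
    qed auto
    have first: "runs w [Mv 0 True] (heads [0, 0, 0, 0, 0, 0], out) (heads [Suc 0, 0, 0, 0, 0, 0], out) 1" for out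
      using runs_Mv_right[of 0 "[0, 0, 0, 0, 0, 0]" w out] by simp
    have input': "runs w [While 0 [Bit False, Bit True] ?body] (heads [Suc 0, 0, 0, 0, 0, 0], out)
       (heads [Suc ?n, ?n, 0, 0, 0, 0], out @ ?in) (Suc (?n * Suc (Suc (?B ?n) + (Suc (?B ?n) + 2))))"
      for out using input[of out] by simp
    have loop': "runs w (drain 3 (emit 5 L @ [Mv 5 True])) (heads [Suc ?n, ?n, 0, ?m ?n, 0, 0], out)
       (heads [Suc ?n, ?n, 0, 0, 0, ?m ?n], out @ ?loop) (Suc (?m ?n * (?B (?m ?n) + 1 + 2)))"
      for out using loop[of out] by simp
    note rules = emit1[of A 0 ?n, OF _ le0] first input' emit1[of E ?n ?n, OF _ order_refl] T(2) loop'
      emit5[of Z "?m ?n" "?m ?n", OF _ order_refl]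
    show ?thesis unfolding template_prog_def h0
      by ((rule runs_append, rule rules, (simp; fail)?)+, rule rules, simp)
  qed
  then have "\<exists>h t. runs w (template_prog p A I E L Z) (\<lambda>_. 0, []) (h, let n = length w; m = poly p n in
     fill 0 A @ concat (map (\<lambda>j. fill j (I (w ! j))) [0..<n]) @ fill n E @
     concat (map (\<lambda>j. fill j L) [0..<m]) @ fill m Z) t \<and> t \<le> poly q (length w)" for w
    using q[of "length w"] unfolding Let_def by (fastforce simp: append_assoc)
  then show ?thesis by (intro polytime_computable_prog[OF tapes_below_template_prog]) auto
qed


section \<open>Local description of a run\<close>

type_synonym sval = "bool \<times> nat \<times> sym option list"

text \<open>The value at time \<open>t\<close> and offset \<open>d\<close>: whether the offset is zero, the state, and the symbols at
  distance \<open>d\<close> from the heads. Offsets are taken modulo \<open>2 ^ m\<close>, and \<open>None\<close> is the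
  content of a fictitious cell to the left of cell \<open>0\<close>, where the circle closes.\<close>

definition run_val :: "tm \<Rightarrow> bool list \<Rightarrow> nat \<Rightarrow> nat \<Rightarrow> int \<Rightarrow> sval" where
  "run_val M w m t d = (2 ^ m dvd d, fst (tm_run M w t),
     map (\<lambda>(f, h). let a = (d + int h + 1) mod 2 ^ m in if a = 0 then None else Some (f (nat a - 1)))
       (snd (tm_run M w t)))"

text \<open>Here \<open>z\<close> supplies the state and the scanned symbols, and \<open>e\<close>
  tells which heads stand on cell 0. After a right move the cell at offset \<open>d\<close> is the
  one formerly at \<open>d + 1\<close>, after a proper left move the one at \<open>d - 1\<close>. If
  that source was the scanned cell it now holds the written symbol, which is why values record
  whether their offset is zero.\<close>

definition run_step :: "tm \<Rightarrow> sval \<Rightarrow> sval \<Rightarrow> sval \<Rightarrow> sval \<Rightarrow> sval \<Rightarrow> sval" where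
  "run_step M l c r z e = (let q = fst (snd z) in
     if q \<in> {accept M, reject M} then c
     else let (q', as) = delta M q (map the (snd (snd z))) in
       (fst c, q', map (\<lambda>i.
          let src = (case snd (as ! i) of Stay \<Rightarrow> c | MoveRight \<Rightarrow> r
            | MoveLeft \<Rightarrow> if snd (snd e) ! i = None then c else l)
          in if fst src then Some (fst (as ! i)) else snd (snd src) ! i) [0..<tapes M]))"

definition run_vals :: "tm \<Rightarrow> sval set" where
  "run_vals M = UNIV \<times> states M \<times> {l. set l \<subseteq> insert None (Some ` symbols M) \<and> length l = tapes M}"

lemma finite_run_vals: "turing_machine M \<Longrightarrow> finite (run_vals M)"
  unfolding run_vals_def turing_machine_def
  by (intro finite_cartesian_product finite_lists_length_eq) auto

lemma tm_run_Suc: "tm_run M w (Suc t) = tm_step M (tm_run M w t)"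
  by (simp add: tm_run_def)

lemma tm_run_0: "tm_run M w 0 = start_config M w"
  by (simp add: tm_run_def)

lemma tm_run_invariant:
  assumes M: "turing_machine M"
  shows "fst (tm_run M w t) \<in> states M \<and> length (snd (tm_run M w t)) = tapes M \<and>
    (\<forall>T\<in>set (snd (tm_run M w t)). snd T \<le> t \<and> range (fst T) \<subseteq> symbols M)"
proof (induction t)
  case 0
  have s: "{Blank, Start, Bit False, Bit True} \<subseteq> symbols M" "init M \<in> states M" "1 \<le> tapes M"
    using M by (auto simp: turing_machine_def)
  then have "word_tape v i \<in> symbols M" for v i
    by (cases "v ! (i - 1)") (auto simp: word_tape_def)
  then show ?case using s by (auto simp: tm_run_0 start_config_def)
next
  case (Suc t)
  obtain q ts where c: "tm_run M w t = (q, ts)" by fastforce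
  show ?case
  proof (cases "halted M (q, ts)")
    case True
    then show ?thesis using Suc by (auto simp: tm_run_Suc c tm_step_def)
  next
    case False
    obtain q' as where d: "delta M q (map read_tape ts) = (q', as)" by fastforce
    have q: "q \<in> states M" "length ts = tapes M"
      and T: "\<And>T. T \<in> set ts \<Longrightarrow> snd T \<le> t \<and> range (fst T) \<subseteq> symbols M"
      using Suc c by auto
    have "set (map read_tape ts) \<subseteq> symbols M"
      using T by (fastforce simp: read_tape_def)
    then have as: "q' \<in> states M \<and> length as = tapes M \<and> fst ` set as \<subseteq> symbols M"
      using M d q unfolding turing_machine_def by (metis length_map)
    have "snd (act a T) \<le> Suc t \<and> range (fst (act a T)) \<subseteq> symbols M"
      if "a \<in> set as" "T \<in> set ts" for a T
    proof -
      have "snd (act a T) \<le> Suc (snd T)" by (cases "snd a") (auto simp: act_def)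
      moreover have "fst a \<in> symbols M" using as that by blast
      ultimately show ?thesis using T[OF that(2)] by (auto simp: act_def)
    qed
    note act = this
    have "snd T \<le> Suc t \<and> range (fst T) \<subseteq> symbols M" if "T \<in> set (map2 act as ts)" for T
    proof -
      from that obtain a T' where "(a, T') \<in> set (zip as ts)" "T = act a T'" by auto
      then show ?thesis using act set_zip_leftD set_zip_rightD by metis
    qed
    then have "\<forall>T\<in>set (map2 act as ts). snd T \<le> Suc t \<and> range (fst T) \<subseteq> symbols M" by blast
    then show ?thesis using as q False by (simp add: tm_run_Suc c tm_step_def d)
  qed
qed

lemma run_val_in_run_vals:
  assumes "turing_machine M"
  shows "run_val M w m t d \<in> run_vals M"
  using tm_run_invariant[OF assms, of w t]
  by (fastforce simp: run_val_def run_vals_def Let_def)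

lemma run_val_mod: "run_val M w m t (d mod 2 ^ m) = run_val M w m t d"
proof -
  have "(d mod 2 ^ m + int h + 1) mod 2 ^ m = (d + int h + 1) mod 2 ^ m" for h
    by (metis (no_types, opaque_lifting) add.assoc mod_add_left_eq)
  moreover have "2 ^ m dvd d mod 2 ^ m \<longleftrightarrow> 2 ^ m dvd d" by (simp add: dvd_eq_mod_eq_0)
  ultimately show ?thesis by (simp add: run_val_def)
qed

lemma run_val_0:
  assumes "tapes M \<ge> 1" "0 \<le> d" "d < 2 ^ m" "length w + 2 \<le> 2 ^ m"
  shows "run_val M w m 0 d =
    (if d = 0 then (True, init M, replicate (tapes M) (Some Start))
     else if d \<le> int (length w) then (False, init M, Some (Bit (w ! (nat d - 1))) # replicate (tapes M - 1) (Some Blank))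
     else if d = 2 ^ m - 1 then (False, init M, replicate (tapes M) None)
     else (False, init M, replicate (tapes M) (Some Blank)))"
proof -
  have size: "int (length w) + 2 \<le> 2 ^ m"
    using assms(4) by (metis of_nat_add of_nat_le_iff of_nat_numeral of_nat_power)
  obtain k where k: "tapes M = Suc k" using assms(1) by (cases "tapes M") auto
  have dvd: "2 ^ m dvd d \<longleftrightarrow> d = 0"
    using assms(2,3) zdvd_imp_le[of "2 ^ m" d] by fastforce
  define g where "g = (\<lambda>(f :: nat \<Rightarrow> sym, h). let a = (d + int h + 1) mod 2 ^ m in if a = 0 then None else Some (f (nat a - 1)))"
  have g: "g (f, 0) = (if d = 2 ^ m - 1 then None else Some (f (nat d)))" for f
  proof (cases "d = 2 ^ m - 1")
    case False
    then have "(d + 1) mod 2 ^ m = d + 1" using assms(2,3) by (intro mod_pos_pos_trivial) auto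
    then show ?thesis using assms(2) False by (simp add: g_def Let_def nat_add_distrib)
  qed (simp add: g_def)
  have "run_val M w m 0 d = (d = 0, init M, g (word_tape w, 0) # replicate k (g (word_tape [], 0)))"
    by (simp add: run_val_def tm_run_0 start_config_def dvd g_def[symmetric] k)
  then show ?thesis
    unfolding g using size assms(2,3) by (auto simp: k word_tape_def nat_le_iff)
qed

text \<open>The position bound keeps all heads on the genuine cells 0 to 2 ^ m - 2 of the circle.
  Hence offset 0 is never the fictitious cell, and that cell is never overwritten.\<close>

lemma run_val_Suc:
  assumes M: "turing_machine M" and pos: "\<And>T. T \<in> set (snd (tm_run M w t)) \<Longrightarrow> snd T + 2 \<le> 2 ^ m"
  shows "run_val M w m (Suc t) d = run_step M (run_val M w m t (d - 1)) (run_val M w m t d)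
     (run_val M w m t (d + 1)) (run_val M w m t 0) (run_val M w m t (- 1))"
proof -
  define N :: int where "N = 2 ^ m"
  obtain q ts where c: "tm_run M w t = (q, ts)" by fastforce
  have len: "length ts = tapes M" "q \<in> states M" "\<And>T. T \<in> set ts \<Longrightarrow> range (fst T) \<subseteq> symbols M"
    using tm_run_invariant[OF M, of w t] c by auto
  define g where "g = (\<lambda>d (f :: nat \<Rightarrow> sym, h). let a = (d + int h + 1) mod N in if a = 0 then None else Some (f (nat a - 1)))"
  have val: "run_val M w m t d = (N dvd d, q, map (g d) ts)" for d
    by (simp add: run_val_def c g_def N_def)
  show ?thesis
  proof (cases "halted M (q, ts)")
    case True
    then have "tm_run M w (Suc t) = tm_run M w t" by (simp add: tm_run_Suc c tm_step_def)
    then have "run_val M w m (Suc t) d = run_val M w m t d" by (simp add: run_val_def)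
    then show ?thesis using True by (simp add: val run_step_def halted_def)
  next
    case False
    obtain q' as where d: "delta M q (map read_tape ts) = (q', as)" by fastforce
    have bound: "int h + 1 < N" if "(f, h) \<in> set ts" for f h
    proof -
      have "h + 2 \<le> 2 ^ m" using pos[of "(f, h)"] that c by simp
      then have "int (h + 2) \<le> int (2 ^ m)" by (simp only: of_nat_le_iff)
      then show ?thesis by (simp add: N_def)
    qed
    have g0: "the (g 0 T) = read_tape T" if "T \<in> set ts" for T
    proof -
      obtain f h where T: "T = (f, h)" by fastforce
      have "(int h + 1) mod N = int h + 1"
        using bound that T by (intro mod_pos_pos_trivial) auto
      then show ?thesis by (simp add: T g_def Let_def read_tape_def nat_add_distrib)
    qed
    then have reads: "map the (map (g 0) ts) = map read_tape ts" by simp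
    have "set (map read_tape ts) \<subseteq> symbols M"
      using len(3) by (fastforce simp: read_tape_def)
    then have as: "length as = tapes M"
      using M d len unfolding turing_machine_def by (metis length_map)
    \<comment> \<open>Where the content at offset \<open>d\<close> after one action comes from:
      first the write at the old head, then the shift by the move.\<close>
    have cell: "g d (act (s, dr) T) = (let src = (case dr of Stay \<Rightarrow> d | MoveRight \<Rightarrow> d + 1
            | MoveLeft \<Rightarrow> if g (- 1) T = None then d else d - 1)
          in if N dvd src then Some s else g src T)" if T: "T \<in> set ts" for s dr T d
    proof -
      obtain f h where fh: "T = (f, h)" by fastforce
      have h: "int h + 1 < N" using bound T fh by simp
      \<comment> \<open>An offset meets the written cell exactly when it is 0 on the circle of
        length \<open>N\<close>.\<close>
      have upd: "g e (f(h := s), h) = (if N dvd e then Some s else g e (f, h))" for e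
      proof -
        have "(e + int h + 1) mod N = int h + 1 \<longleftrightarrow> N dvd e"
        proof -
          have "(e + (int h + 1)) mod N = (int h + 1) mod N \<longleftrightarrow> N dvd e"
            by (simp add: mod_eq_dvd_iff)
          then show ?thesis using h by (simp add: add.assoc)
        qed
        moreover have "0 \<le> (e + int h + 1) mod N" using h by simp
        ultimately show ?thesis
          by (auto simp: g_def Let_def nat_add_distrib split: if_splits)
      qed
      have shift: "g e (f', Suc h') = g (e + 1) (f', h')" for e f' h'
        by (simp add: g_def add_ac)
      \<comment> \<open>At offset -1 the residue tested is that of \<open>h\<close> itself, and
        \<open>h\<close> is below \<open>N\<close>.\<close>
      have out: "g (- 1) (f, h) = None \<longleftrightarrow> h = 0" using h by (simp add: g_def Let_def)
      show ?thesis
      proof (cases dr)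
        case MoveLeft
        show ?thesis
        proof (cases h)
          case 0
          then show ?thesis using MoveLeft out upd[of d] by (simp add: fh act_def)
        next
          case (Suc h')
          have "g (- 1) T \<noteq> None" using out Suc fh by simp
          then show ?thesis using MoveLeft Suc upd[of "d - 1"] shift[of "d - 1" "f(h := s)" h']
            by (cases "N dvd d - 1") (auto simp: fh act_def Let_def)
        qed
      next
        case Stay
        then show ?thesis using upd[of d] by (simp add: fh act_def)
      next
        case MoveRight
        then show ?thesis using upd[of "d + 1"] shift[of d "f(h := s)" h] by (simp add: fh act_def)
      qed
    qed
    have "run_val M w m (Suc t) d = (N dvd d, q', map (g d) (map2 act as ts))"
      using False by (simp add: run_val_def tm_run_Suc c tm_step_def d g_def N_def)
    moreover have "map (g d) (map2 act as ts) = map (\<lambda>i.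
          let src = (case snd (as ! i) of Stay \<Rightarrow> run_val M w m t d | MoveRight \<Rightarrow> run_val M w m t (d + 1)
            | MoveLeft \<Rightarrow> if snd (snd (run_val M w m t (- 1))) ! i = None then run_val M w m t d
                else run_val M w m t (d - 1))
          in if fst src then Some (fst (as ! i)) else snd (snd src) ! i) [0..<tapes M]"
    proof (rule nth_equalityI)
      fix i assume "i < length (map (g d) (map2 act as ts))"
      then have i: "i < length ts" "i < length as" "i < tapes M" using as len by auto
      then show "map (g d) (map2 act as ts) ! i = map (\<lambda>i.
          let src = (case snd (as ! i) of Stay \<Rightarrow> run_val M w m t d | MoveRight \<Rightarrow> run_val M w m t (d + 1)
            | MoveLeft \<Rightarrow> if snd (snd (run_val M w m t (- 1))) ! i = None then run_val M w m t d
                else run_val M w m t (d - 1))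
          in if fst src then Some (fst (as ! i)) else snd (snd src) ! i) [0..<tapes M] ! i"
        using cell[of "ts ! i" d "fst (as ! i)" "snd (as ! i)"]
        by (cases "as ! i"; cases "snd (as ! i)") (auto simp: val Let_def)
    qed (use as len in auto)
    moreover have "q \<notin> {accept M, reject M}" using False by (simp add: halted_def)
    ultimately show ?thesis
      unfolding run_step_def by (simp add: val reads[unfolded map_map] d Let_def)
  qed
qed

text \<open>A head moves at most one cell per step and nothing moves after
  \<open>f (length w)\<close> steps, so positions never exceed that number; for the same reason the
  state at time 2 ^ m - 1 is the verdict.\<close>

lemma run_bounds:
  assumes M: "turing_machine M" and dec: "decides_in_time M L f" and "f (length w) + 2 \<le> 2 ^ m"
  shows "T \<in> set (snd (tm_run M w t)) \<Longrightarrow> snd T + 2 \<le> 2 ^ m"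
    and "fst (snd (run_val M w m (2 ^ m - 1) 0)) = accept M \<longleftrightarrow> w \<in> L"
proof -
  have st: "fst (tm_run M w (f (length w))) = (if w \<in> L then accept M else reject M)"
    using dec by (simp add: decides_in_time_def)
  have h: "tm_run M w t = tm_run M w (f (length w))" if "f (length w) \<le> t" for t
    using halted_run[OF _ that] st by (simp add: halted_def)
  show "snd T + 2 \<le> 2 ^ m" if "T \<in> set (snd (tm_run M w t))"
  proof (cases "f (length w) \<le> t")
    case True
    then have "T \<in> set (snd (tm_run M w (f (length w))))" using h[of t] that by simp
    then have "snd T \<le> f (length w)" using tm_run_invariant[OF M, of w "f (length w)"] by blast
    then show ?thesis using assms(3) by simp
  next
    case False
    have "snd T \<le> t" using tm_run_invariant[OF M, of w t] that by blast
    then show ?thesis using False assms(3) by simp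
  qed
  have "accept M \<noteq> reject M" using M by (simp add: turing_machine_def)
  moreover have "f (length w) \<le> 2 ^ m - 1" using assms(3) by simp
  ultimately show "fst (snd (run_val M w m (2 ^ m - 1) 0)) = accept M \<longleftrightarrow> w \<in> L"
    using h[of "2 ^ m - 1"] st by (simp add: run_val_def)
qed


section \<open>The reduction\<close>

text \<open>The family is coded by a constant prefix and the index in unary, so a counter can print
  it; indices are polynomially bounded, hence names remain short enough.\<close>

definition name_of :: "'v::countable family \<times> nat \<Rightarrow> name" where
  "name_of = (\<lambda>(F, j). replicate (to_nat F) False @ replicate (Suc j) True)"

lemma inj_name_of: "inj (name_of :: 'a::countable family \<times> nat \<Rightarrow> name)"
proof -
  have prefix: "takeWhile Not (replicate a False @ replicate (Suc i) True) = replicate a False" for a i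
    by (induction a) simp_all
  have inj: "a = b \<and> i = j"
    if "replicate a False @ replicate (Suc i) True = replicate b False @ replicate (Suc j) True" for a b i j
  proof -
    have "replicate a False = replicate b False" using prefix[of a i] prefix[of b j] that by argo
    then have "a = b" by simp
    then show ?thesis using arg_cong[OF that, of length] by simp
  qed
  show ?thesis
  proof (rule injI)
    fix x y :: "'a family \<times> nat"
    assume "name_of x = name_of y"
    moreover obtain F i where "x = (F, i)" by (rule prod.exhaust)
    moreover obtain G j where "y = (G, j)" by (rule prod.exhaust)
    ultimately show "x = y" using inj[of "to_nat F" i "to_nat G" j]
      by (simp add: name_of_def del: replicate_Suc)
  qed
qed

section \<open>Change of concept names\<close>

lemma ext_map:
  assumes "\<And>\<pi>. gamma S \<pi> = \<lparr>conc_int = \<lambda>A. conc_int (gamma S' \<pi>) (f A), role_int = role_int (gamma S' \<pi>),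
      ind_int = ind_int (gamma S' \<pi>)\<rparr>"
    and "Delta S = Delta S'" "sigma S = sigma S'"
  shows "ext S \<pi> C = ext S' \<pi> (map_cterm f id id id C)"
proof (induction C arbitrary: \<pi>)
  case (Modal m C)
  then show ?case by (cases m) (simp_all add: assms standpoint.map_id standpoint.map_ident)
qed (simp_all add: assms)

text \<open>The structure is pulled back along \<open>f\<close>, reading each concept name
  \<open>A\<close> as \<open>f A\<close>. It serves both directions of the reduction, with
  \<open>name_of\<close> and with its inverse.\<close>

lemma satisfiable_map:
  fixes S' :: "('e, 'r, 'i, 's, 'd, 'p) sp_struct"
  assumes "standpoint_structure S'" "\<forall>g\<in>map_gci f id id id ` T. sat_gci S' g"
  shows "\<exists>S :: ('c, 'r, 'i, 's, 'd, 'p) sp_struct. standpoint_structure S \<and> (\<forall>g\<in>T. sat_gci S g)"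
proof -
  define S :: "('c, 'r, 'i, 's, 'd, 'p) sp_struct" where
    "S = \<lparr>Delta = Delta S', Prec = Prec S', sigma = sigma S',
       gamma = \<lambda>\<pi>. \<lparr>conc_int = \<lambda>A. conc_int (gamma S' \<pi>) (f A), role_int = role_int (gamma S' \<pi>),
         ind_int = ind_int (gamma S' \<pi>)\<rparr>\<rparr>"
  have fields: "Delta S = Delta S'" "Prec S = Prec S'" "sigma S = sigma S'"
    "conc_int (gamma S \<pi>) A = conc_int (gamma S' \<pi>) (f A)"
    "role_int (gamma S \<pi>) = role_int (gamma S' \<pi>)" "ind_int (gamma S \<pi>) = ind_int (gamma S' \<pi>)" for \<pi> A
    by (simp_all add: S_def)
  have "standpoint_structure S"
    using assms(1) unfolding standpoint_structure_def dl_interpretation_def fields by blast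
  moreover have "sat_gci S g \<longleftrightarrow> sat_gci S' (map_gci f id id id g)" for g
  proof -
    have ext: "ext S \<pi> C = ext S' \<pi> (map_cterm f id id id C)" for \<pi> C
      by (rule ext_map) (simp_all add: S_def)
    obtain m C D where g: "g = GCI m C D" by (rule gci.exhaust)
    show ?thesis
      by (cases m) (simp_all add: g ext fields(3) standpoint.map_id standpoint.map_ident)
  qed
  ultimately show ?thesis using assms(2) by blast
qed

subsection \<open>Encoding templates\<close>

lemma fill_append [simp]: "fill j (ps @ qs) = fill j ps @ fill j qs"
  by (simp add: fill_def)

lemma fill_Cons [simp]:
  "fill j (Some b # ps) = b # fill j ps" "fill j (None # ps) = replicate (2 * j) True @ fill j ps"
  "fill j [] = []"
  by (simp_all add: fill_def)

lemma fill_map_Some [simp]: "fill j (map Some bs) = bs"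
  by (induction bs) simp_all

text \<open>As the unary index ends the name, adding the index of the instance means inserting
  further pairs \<open>True, True\<close> just before the terminating \<open>False\<close>.\<close>

fun atom_pieces :: "'v::countable family \<times> nat \<times> bool \<Rightarrow> pieces" where
  "atom_pieces (F, k, u) =
     map Some (concat (replicate (to_nat F) [True, False]) @ replicate (2 * Suc k) True) @
     (if u then [None] else []) @ [Some False]"

lemma enc_name_replicate: "enc_name (replicate n b @ xs) = concat (replicate n [True, b]) @ enc_name xs"
  by (induction n) auto

lemma concat_replicate_True: "concat (replicate n [True, True]) = replicate (2 * n) True"
  by (induction n) auto

lemma fill_atom: "fill j (atom_pieces A) = enc_name (name_of (index j A))"
proof -
  obtain F k u where A: "A = (F, k, u)" by (rule prod_cases3)
  have "enc_name (replicate n True) = replicate (2 * n) True @ [False]" for n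
    using enc_name_replicate[of n True "[]"] by (simp add: concat_replicate_True)
  moreover have "replicate (2 * Suc (k + j)) True = replicate (2 * Suc k) True @ replicate (2 * j) True"
    by (simp add: replicate_add[symmetric])
  ultimately show ?thesis
    by (cases u) (simp_all add: A name_of_def enc_name_replicate del: replicate_Suc mult_Suc_right map_replicate)
qed

fun cterm_pieces :: "'v::countable tcterm \<Rightarrow> pieces" where
  "cterm_pieces Top = map Some [False, False, False]"
| "cterm_pieces Bot = map Some [False, False, True]"
| "cterm_pieces (Atom A) = map Some [False, True, False] @ atom_pieces A"
| "cterm_pieces (Nominal a) = map Some ([False, True, True] @ enc_name a)"
| "cterm_pieces (And C D) = map Some [True, False, False] @ cterm_pieces C @ cterm_pieces D"
| "cterm_pieces (Ex R C) = map Some ([True, False, True] @ enc_name R) @ cterm_pieces C"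
| "cterm_pieces (Modal m C) = map Some ([True, True, False] @ enc_modop m) @ cterm_pieces C"

fun gci_pieces :: "'v::countable tgci \<Rightarrow> pieces" where
  "gci_pieces (GCI m C D) = map Some (enc_modop m) @ cterm_pieces C @ cterm_pieces D"

definition gcis_pieces :: "'v::countable tgci list \<Rightarrow> pieces" where
  "gcis_pieces gs = concat (map (\<lambda>g. Some True # gci_pieces g) gs)"

definition rename :: "'v::countable agci list \<Rightarrow> ngci list" where
  "rename = map (map_gci name_of id id id)"

lemma fill_cterm:
  "fill j (cterm_pieces C) = enc_cterm (map_cterm name_of id id id (map_cterm (index j) id id id C))"
  by (induction C) (simp_all add: fill_atom modop.map_id modop.map_ident del: atom_pieces.simps)

text \<open>The encoding without its terminator, so that it turns concatenation of TBoxes into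
  concatenation of words.\<close>

definition enc_gcis :: "ngci list \<Rightarrow> bool list" where
  "enc_gcis gs = concat (map (\<lambda>g. True # enc_gci g) gs)"

lemma enc_gcis_append: "enc_gcis (gs @ hs) = enc_gcis gs @ enc_gcis hs"
  by (simp add: enc_gcis_def)

lemma enc_gcis_concat: "enc_gcis (concat gss) = concat (map enc_gcis gss)"
  by (induction gss) (simp_all add: enc_gcis_def)

lemma enc_tbox_eq: "enc_tbox gs = enc_gcis gs @ [False]"
  by (induction gs) (simp_all add: enc_gcis_def)

lemma fill_gcis: "fill j (gcis_pieces gs) = enc_gcis (rename (inst j gs))"
proof (induction gs)
  case Nil
  then show ?case by (simp add: gcis_pieces_def enc_gcis_def rename_def inst_def)
next
  case (Cons g gs)
  have "fill j (gci_pieces g) = enc_gci (map_gci name_of id id id (map_gci (index j) id id id g))"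
    by (cases g) (simp add: fill_cterm modop.map_id modop.map_ident)
  then show ?case using Cons by (simp add: gcis_pieces_def enc_gcis_def rename_def inst_def)
qed

lemma rename_append: "rename (gs @ hs) = rename gs @ rename hs"
  by (simp add: rename_def)

lemma rename_concat: "rename (concat gss) = concat (map rename gss)"
  by (simp add: rename_def map_concat)

text \<open>For a fixed machine all templates are constants of the program, including the large
  table of step rules; the input contributes only its letters and the indices.\<close>

lemma polytime_tbox:
  fixes vals :: "'v::countable list"
  shows "polytime_computable (\<lambda>w. enc_tbox (rename
    (tableau.tbox vals step v_start v_bit v_blank v_out bad w (poly p (length w)))))"
proof -
  interpret tableau vals step v_start v_bit v_blank v_out bad .
  have eq: "enc_tbox (rename (tbox w (poly p (length w)))) = (let n = length w; m = poly p n in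
     fill 0 (gcis_pieces const_gcis) @ concat (map (\<lambda>j. fill j (gcis_pieces (input_gcis (w ! j)))) [0..<n]) @
     fill n (gcis_pieces (big_gcis :: 'v tgci list)) @
     concat (map (\<lambda>j. fill j (gcis_pieces (bit_gcis :: 'v tgci list))) [0..<m]) @
     fill m (gcis_pieces (end_gcis :: 'v tgci list) @ [Some False]))" for w
    by (simp add: Let_def tbox_def enc_tbox_eq rename_append rename_concat enc_gcis_append enc_gcis_concat
        fill_gcis comp_def)
  show ?thesis
    unfolding eq by (rule polytime_computable_template[where I = "\<lambda>b. gcis_pieces (input_gcis b)"])
qed

subsection \<open>Nominals\<close>

definition nil_nominals :: "('c, 'r, name, 's) gci list \<Rightarrow> bool" where
  "nil_nominals gs \<longleftrightarrow> (\<forall>g\<in>set gs. gci_nominals g \<subseteq> {[]})"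

lemma nil_nominals_simps [simp]:
  "nil_nominals []" "nil_nominals (g # gs) \<longleftrightarrow> gci_nominals g \<subseteq> {[]} \<and> nil_nominals gs"
  "nil_nominals (gs @ hs) \<longleftrightarrow> nil_nominals gs \<and> nil_nominals hs"
  "nil_nominals (concat gss) \<longleftrightarrow> (\<forall>gs\<in>set gss. nil_nominals gs)"
  "nil_nominals (map f xs) \<longleftrightarrow> (\<forall>x\<in>set xs. gci_nominals (f x) \<subseteq> {[]})"
  by (auto simp: nil_nominals_def)

lemma cterm_nominals_map: "cterm_nominals (map_cterm f id id id C) = cterm_nominals C"
  by (induction C) simp_all

lemma gci_nominals_map: "gci_nominals (map_gci f id id id g) = gci_nominals g"
  by (cases g) (simp add: cterm_nominals_map)

lemma nil_nominals_inst: "nil_nominals gs \<Longrightarrow> nil_nominals (inst j gs)"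
  by (simp add: inst_def gci_nominals_map nil_nominals_def)

lemma nil_nominals_tbox:
  fixes vals :: "'v list"
  shows "nil_nominals (tableau.tbox vals step v_start v_bit v_blank v_out bad w m)"
proof -
  interpret tableau vals step v_start v_bit v_blank v_out bad .
  have "nil_nominals const_gcis" "nil_nominals (input_gcis b)" "nil_nominals (big_gcis :: 'v tgci list)"
    "nil_nominals (bit_gcis :: 'v tgci list)" "nil_nominals (end_gcis :: 'v tgci list)" for b
    by (simp_all add: const_gcis_def input_gcis_def big_gcis_def bit_gcis_def end_gcis_def split_beta
        imp_def push_def up_def)
  then show ?thesis by (simp add: tbox_def nil_nominals_inst)
qed

lemma tbox_nominals_rename:
  fixes vals :: "'v::countable list"
  shows "tbox_nominals (set (rename (tableau.tbox vals step v_start v_bit v_blank v_out bad w m))) = {[]}"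
proof
  show "tbox_nominals (set (rename (tableau.tbox vals step v_start v_bit v_blank v_out bad w m))) \<subseteq> {[]}"
    using nil_nominals_tbox[of vals step v_start v_bit v_blank v_out bad w m]
    by (auto simp: tbox_nominals_def rename_def nil_nominals_def gci_nominals_map)
  \<comment> \<open>This rule belongs to every TBox produced, so the nominal really occurs and the
    set is not empty.\<close>
  define g :: "'v agci" where "g = GCI (Box Star) Top (Ex [] (Nominal []))"
  have "g \<in> set (tableau.tbox vals step v_start v_bit v_blank v_out bad w m)"
    by (simp add: tableau.tbox_def tableau.const_gcis_def g_def)
  then have "map_gci name_of id id id g \<in> set (rename (tableau.tbox vals step v_start v_bit v_blank v_out bad w m))"
    by (simp add: rename_def)
  moreover have "gci_nominals (map_gci name_of id id id g) = {[]}" by (simp add: g_def)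
  ultimately show "{[]} \<subseteq> tbox_nominals (set (rename (tableau.tbox vals step v_start v_bit v_blank v_out bad w m)))"
    unfolding tbox_nominals_def by blast
qed

subsection \<open>Correctness\<close>

theorem mainTheorem4:
  shows "exptime_hard enc_tbox {T. \<exists>a. tbox_nominals (set T) = {a}}
           (\<lambda>T. satisfiable TYPE('d::infinite) TYPE('p::infinite) (set T))"
  unfolding exptime_hard_def
proof
  fix L assume "L \<in> EXPTIME"
  then obtain M p where M: "turing_machine M" and dec: "decides_in_time M L (\<lambda>n. 2 ^ poly p n)"
    unfolding EXPTIME_def by blast
  obtain vals where vals: "set vals = run_vals M"
    using finite_list[OF finite_run_vals[OF M]] by blast
  \<comment> \<open>The summand is n + 2. It makes 2 ^ m large enough for both requirements: 2 ^
    p(n) + 2 for times and head positions, n + 2 for the input next to the fictitious cell.\<close>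
  define q where "q = p + [:2, 1:]"
  define bad where "bad = (\<lambda>v :: sval. fst (snd v) \<noteq> accept M)"
  let ?k = "tapes M"
  define tb where "tb = (\<lambda>w m. tableau.tbox vals (run_step M) (True, init M, replicate ?k (Some Start))
    (\<lambda>b. (False, init M, Some (Bit b) # replicate (?k - 1) (Some Blank)))
    (False, init M, replicate ?k (Some Blank)) (False, init M, replicate ?k None) bad w m)"
  define g where "g = (\<lambda>w. rename (tb w (poly q (length w))))"
  have "w \<in> L \<longleftrightarrow> satisfiable TYPE('d) TYPE('p) (set (g w))" for w
  proof -
    define m where "m = poly q (length w)"
    have m: "m = poly p (length w) + length w + 2" by (simp add: m_def q_def)
    have "2 ^ m = (2 :: nat) ^ poly p (length w) * 2 ^ length w * 4"
      by (simp add: m power_add)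
    moreover have "(1 :: nat) \<le> 2 ^ poly p (length w)" "1 \<le> (2 :: nat) ^ length w" by simp_all
    moreover have "length w < 2 ^ length w" by (rule less_exp)
    ultimately have sz: "2 ^ poly p (length w) + 2 \<le> (2 :: nat) ^ m" "length w + 2 \<le> 2 ^ m"
      using mult_le_mono[of 1 "2 ^ poly p (length w)" "2 ^ length w" "2 ^ length w"]
        mult_le_mono[of "2 ^ poly p (length w)" "2 ^ poly p (length w)" 1 "2 ^ length w"] by linarith+
    interpret tableau_run vals "run_step M" "(True, init M, replicate ?k (Some Start))"
      "\<lambda>b. (False, init M, Some (Bit b) # replicate (?k - 1) (Some Blank))"
      "(False, init M, replicate ?k (Some Blank))" "(False, init M, replicate ?k None)" bad w m "run_val M w m"
    proof
      show "length w + 2 \<le> 2 ^ m" by (fact sz(2))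
      show "run_val M w m t d \<in> set vals" for t d using run_val_in_run_vals[OF M] vals by simp
      show "run_val M w m t (d mod 2 ^ m) = run_val M w m t d" for t d by (fact run_val_mod)
      show "run_val M w m 0 d = (if d = 0 then (True, init M, replicate ?k (Some Start))
         else if d \<le> int (length w) then (False, init M, Some (Bit (w ! (nat d - 1))) # replicate (?k - 1) (Some Blank))
         else if d = 2 ^ m - 1 then (False, init M, replicate ?k None)
         else (False, init M, replicate ?k (Some Blank)))" if "0 \<le> d" "d < 2 ^ m" for d
        using run_val_0[OF _ that sz(2)] M by (simp add: turing_machine_def)
      show "run_val M w m (Suc t) d = run_step M (run_val M w m t (d - 1)) (run_val M w m t d)
         (run_val M w m t (d + 1)) (run_val M w m t 0) (run_val M w m t (- 1))" for t d
        using run_val_Suc[OF M] run_bounds(1)[OF M dec sz(1)] by blast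
    qed
    have tb: "tb w m = tbox w m" by (simp add: tb_def)
    have set_g: "set (g w) = map_gci name_of id id id ` set (tbox w m)"
      by (simp add: g_def rename_def tb m_def[symmetric])
    have wL: "w \<in> L \<longleftrightarrow> \<not> bad (run_val M w m (2 ^ m - 1) 0)"
      using run_bounds(2)[OF M dec sz(1)] by (simp add: bad_def)
    show ?thesis
    proof
      assume "w \<in> L"
      then have c: "standpoint_structure canon" "\<forall>h\<in>set (tbox w m). sat_gci canon h"
        using satisfiable_tbox_iff(2) wL unfolding sat_all_def by blast+
      have "map_gci (inv name_of) id id id (map_gci name_of id id id h) = h" for h :: "sval agci"
        by (simp add: gci.map_comp inv_o_cancel[OF inj_name_of] gci.map_id)
      then have "map_gci (inv name_of) id id id ` set (g w) = set (tbox w m)"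
        by (simp add: set_g image_image)
      \<comment> \<open>The canonical structure lives over fixed countable types; as all
        vocabularies are countable, satisfiability carries over to the given infinite types.\<close>
      then have "satisfiable TYPE(int \<times> int) TYPE((int \<times> int) \<times> nat) (set (g w))"
        unfolding satisfiable_def using satisfiable_map[OF c(1), of "inv name_of" "set (g w)"] c(2) by simp
      then show "satisfiable TYPE('d) TYPE('p) (set (g w))" by (rule satisfiable_transfer)
    next
      assume "satisfiable TYPE('d) TYPE('p) (set (g w))"
      then obtain S :: "(name, name, name, name, 'd, 'p) sp_struct" where
        "standpoint_structure S" "\<forall>h\<in>map_gci name_of id id id ` set (tbox w m). sat_gci S h"
        unfolding satisfiable_def set_g by blast
      from satisfiable_map[OF this] have
        "\<exists>S :: (sval family \<times> nat, name, name, name, 'd, 'p) sp_struct. standpoint_structure S \<and> sat_all S (tbox w m)"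
        unfolding sat_all_def .
      then show "w \<in> L" using satisfiable_tbox_iff(1) wL by blast
    qed
  qed
  moreover have "tbox_nominals (set (g w)) = {[]}" for w
    unfolding g_def tb_def by (rule tbox_nominals_rename)
  moreover have "polytime_computable (\<lambda>w. enc_tbox (g w))"
    unfolding g_def tb_def by (rule polytime_tbox)
  ultimately show "\<exists>g. (\<forall>w. g w \<in> {T. \<exists>a. tbox_nominals (set T) = {a}} \<and>
      (w \<in> L \<longleftrightarrow> satisfiable TYPE('d) TYPE('p) (set (g w)))) \<and> polytime_computable (\<lambda>w. enc_tbox (g w))"
    by blast
qed

end
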